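(* Let $\alpha$ be a non-zero algebraic number. If $\bar\gamma\in S(K_\alpha)$ satisfies $\bar M(\bar\gamma)\le M(\alpha)$, then there exists a non-zero rational number $r$ such that $\bar M(\bar\gamma^r)=\inf\{\bar M(\bar\gamma^s):s\in\mathbb Q^\times\}$ and $\bar\gamma^r\in\bar{\mathcal B}(\alpha)$.
   Context: For a non-zero algebraic number $\gamma$ with minimal polynomial $A\prod_{n=1}^N(x-\gamma_n)$ over $\mathbb Z$ (primitive, $A>0$), $M(\gamma)=A\prod_{n=1}^N\max\{1,|\gamma_n|\}$. $V=\overline{\mathbb Q}^\times/\mathrm{Tor}(\overline{\mathbb Q}^\times)$ is a $\mathbb Q$-vector space written multiplicatively, with scalar multiplication $\bar\beta\mapsto\bar\beta^s$ ($s\in\mathbb Q$) induced by taking any $s$-th power; $\pi$ is the quotient map. For $\bar\beta\in V$, $\bar M(\bar\beta)=\inf\{M(\beta):\beta\in\pi^{-1}(\bar\beta)\}$. $K_\alpha$ is the Galois closure of $\mathbb Q(\alpha)$ over $\mathbb Q$; $\mathrm{rad}(K)=\{\gamma\in\overline{\mathbb Q}^\times:\gamma^n\in K\text{ for some }n\in\mathbb N\}$ and $S(K)=\pi(\mathrm{rad}(K))$. $\mathcal B(\alpha)=\{\gamma\in K_\alpha^\times:M(\gamma)\le M(\alpha)\}$ and $\bar{\mathcal B}(\alpha)=\pi(\mathcal B(\alpha))$. *)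

theory Defs
  imports "HOL-Analysis.Analysis" "HOL-Computational_Algebra.Polynomial_Factorial"
begin

text \<open>Minimal polynomial over the integers: the irreducible (hence primitive)
  integer polynomial with positive leading coefficient vanishing at x.\<close>
definition minpoly_int :: "complex \<Rightarrow> int poly" where
  "minpoly_int x = (THE p. irreducible p \<and> lead_coeff p > 0 \<and>
                          poly (map_poly of_int p) x = 0)"

definition conjugates :: "complex \<Rightarrow> complex set" where
  "conjugates x = {z. poly (map_poly of_int (minpoly_int x)) z = 0}"

definition mahler :: "complex \<Rightarrow> real" where
  "mahler x = of_int (lead_coeff (minpoly_int x)) * (\<Prod>z\<in>conjugates x. max 1 (cmod z))"

definition is_subfield :: "complex set \<Rightarrow> bool" where
  "is_subfield F \<longleftrightarrow> 0 \<in> F \<and> 1 \<in> F \<and> (\<forall>a\<in>F. \<forall>b\<in>F. a + b \<in> F \<and> a - b \<in> F \<and> a * b \<in> F)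
                    \<and> (\<forall>a\<in>F. a \<noteq> 0 \<longrightarrow> inverse a \<in> F)"

definition galois_closure :: "complex \<Rightarrow> complex set" where
  "galois_closure \<alpha> = \<Inter>{F. is_subfield F \<and> conjugates \<alpha> \<subseteq> F}"

definition rad :: "complex set \<Rightarrow> complex set" where
  "rad K = {\<gamma>. \<gamma> \<noteq> 0 \<and> (\<exists>n::nat. n > 0 \<and> \<gamma> ^ n \<in> K)}"

text \<open>Elements of V are represented by nonzero algebraic numbers (representatives).
  pow_class \<gamma> s is the fibre pi^{-1}(pi(\<gamma>)^s): for s = a/b (b > 0, lowest terms),
  beta lies in it iff beta^b and gamma^a agree modulo torsion.\<close>
definition pow_class :: "complex \<Rightarrow> rat \<Rightarrow> complex set" where
  "pow_class \<gamma> s = {\<beta>. \<beta> \<noteq> 0 \<and> algebraic \<beta> \<and>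
      (\<exists>m::nat. m > 0 \<and> \<beta> powi (int m * snd (quotient_of s)) = \<gamma> powi (int m * fst (quotient_of s)))}"

definition Mbar_pow :: "complex \<Rightarrow> rat \<Rightarrow> real" where
  "Mbar_pow \<gamma> s = Inf (mahler ` pow_class \<gamma> s)"

definition in_S :: "complex \<Rightarrow> complex set \<Rightarrow> bool" where
  "in_S \<gamma> K \<longleftrightarrow> (\<exists>\<beta>\<in>rad K. \<beta> \<in> pow_class \<gamma> 1)"

definition B_set :: "complex \<Rightarrow> complex set" where
  "B_set \<alpha> = {\<gamma>. \<gamma> \<in> galois_closure \<alpha> \<and> \<gamma> \<noteq> 0 \<and> mahler \<gamma> \<le> mahler \<alpha>}"

end

theory Submission
  imports Defs "HOL-Computational_Algebra.Fundamental_Theorem_Algebra" "Jordan_Normal_Form.Char_Poly"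
begin

text \<open>
  Let $K$ be the Galois closure of $\mathbf{Q}(\alpha)$ and let $\beta$ be a non-zero algebraic number
  with $\beta^n \in K$. The conjugates of $\beta$ over $K$ differ from $\beta$ by roots of unity, so
  their product $x \in K$ is a power $\beta^L$ up to torsion. Each conjugate of $x$ over $\mathbf{Q}$ is
  the product of a block of conjugates of $\beta$, all of the same absolute value, and distinct
  conjugates of $x$ use disjoint blocks. Hence the archimedean part of $M(x)$ is at most that of
  $M(\beta)$. If $A$ is the leading coefficient of the minimal polynomial of $\beta$, then $A$ times any
  product of distinct conjugates of $\beta$ is an algebraic integer; hence $A$ times the monic minimal
  polynomial of $x$ is integral and the leading coefficient for $x$ divides $A$. So
  $M(x) \le M(\beta)$, and the infimum over all powers of $\bar\gamma$ may be taken over elements of $K$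
  only, where Northcott's theorem shows that it is attained.
\<close>

hide_const (open) Module.smult

section \<open>Algebraic integers\<close>

text \<open>Representatives of powers of \<open>\<gamma>\<close> can have arbitrarily large degree,
  so Northcott's theorem says nothing about them directly; inside the Galois closure the degree is
  bounded. The passage from \<beta> to x has a price: x stands for a power
  \<open>\<beta> ^ L\<close>, so the exponent \<open>s\<close> becomes \<open>s * L\<close>. A
  minimum is therefore obtained over all non-zero exponents together, not for a prescribed one, and
  the bound assumed at exponent 1 carries over to it. Two facts carry the descent. Since \<beta>
  need not be integral, closure of the algebraic integers under sums and products does not suffice
  to compare leading coefficients; what is added is that dividing a polynomial with integral
  coefficients by X - z leaves integral coefficients, even for non-integral z. Disjointness of the
  blocks comes from normality: the automorphisms fixing K form a normal subgroup, so every
  automorphism sending \<beta> into its own block permutes that block.\<close>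

definition int_span :: "complex set \<Rightarrow> complex set" where
  "int_span S = {\<Sum>s\<in>S. of_int (c s) * s | c. True}"

lemma int_spanI: "x = (\<Sum>s\<in>S. of_int (c s) * s) \<Longrightarrow> x \<in> int_span S"
  unfolding int_span_def by auto

lemma int_span_zero: "0 \<in> int_span S"
  by (rule int_spanI[where c = "\<lambda>_. 0"]) simp

lemma int_span_base:
  assumes "finite S" "s \<in> S"
  shows "s \<in> int_span S"
proof -
  have "s = (\<Sum>t\<in>S. of_int (if t = s then 1 else 0) * t)"
    using assms by (simp add: if_distrib[of of_int] if_distrib[of "\<lambda>u. u * _"] cong: if_cong)
  thus ?thesis by (rule int_spanI)
qed

lemma int_span_add:
  assumes "x \<in> int_span S" "y \<in> int_span S"
  shows "x + y \<in> int_span S"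
proof -
  obtain c d where "x = (\<Sum>s\<in>S. of_int (c s) * s)" "y = (\<Sum>s\<in>S. of_int (d s) * s)"
    using assms unfolding int_span_def by blast
  hence "x + y = (\<Sum>s\<in>S. of_int (c s + d s) * s)"
    by (simp add: sum.distrib algebra_simps)
  thus ?thesis by (rule int_spanI)
qed

lemma int_span_of_int_mult:
  assumes "x \<in> int_span S"
  shows "of_int k * x \<in> int_span S"
proof -
  obtain c where "x = (\<Sum>s\<in>S. of_int (c s) * s)"
    using assms unfolding int_span_def by blast
  hence "of_int k * x = (\<Sum>s\<in>S. of_int (k * c s) * s)"
    by (simp add: sum_distrib_left algebra_simps)
  thus ?thesis by (rule int_spanI)
qed

lemma int_span_sum: "(\<And>i. i \<in> I \<Longrightarrow> f i \<in> int_span S) \<Longrightarrow> sum f I \<in> int_span S"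
  by (induction I rule: infinite_finite_induct) (auto simp: int_span_zero int_span_add)

lemma int_span_mult:
  assumes "\<And>s. s \<in> S \<Longrightarrow> x * s \<in> int_span S'" "z \<in> int_span S"
  shows "x * z \<in> int_span S'"
proof -
  obtain c where "z = (\<Sum>s\<in>S. of_int (c s) * s)"
    using assms(2) unfolding int_span_def by blast
  hence "x * z = (\<Sum>s\<in>S. of_int (c s) * (x * s))"
    by (simp add: sum_distrib_left algebra_simps)
  also have "\<dots> \<in> int_span S'"
    by (intro int_span_sum int_span_of_int_mult assms(1))
  finally show ?thesis .
qed

text \<open>For finite \<open>S\<close> containing \<open>1\<close> this is the finite-module
  criterion of integrality. One \<open>S\<close> can serve several numbers at once, and the numbers
  stabilizing it are closed under sums and products.\<close>

definition stabilizes :: "complex \<Rightarrow> complex set \<Rightarrow> bool" where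
  "stabilizes x S \<longleftrightarrow> (\<forall>s\<in>S. x * s \<in> int_span S)"

lemma stabilizes_add: "stabilizes x S \<Longrightarrow> stabilizes y S \<Longrightarrow> stabilizes (x + y) S"
  unfolding stabilizes_def by (auto simp: distrib_right intro: int_span_add)

lemma stabilizes_mult: "stabilizes x S \<Longrightarrow> stabilizes y S \<Longrightarrow> stabilizes (x * y) S"
  unfolding stabilizes_def using int_span_mult[of S x S] by (auto simp: mult.assoc)

lemma stabilizes_of_int: "finite S \<Longrightarrow> stabilizes (of_int k) S"
  unfolding stabilizes_def by (auto intro: int_span_of_int_mult int_span_base)

text \<open>An element stabilizing a finitely generated group is an eigenvalue of an integer matrix.\<close>

lemma stabilizes_imp_algebraic_int:
  assumes S: "finite S" "1 \<in> S" and z: "stabilizes z S"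
  shows "algebraic_int z"
proof -
  obtain xs where xs: "set xs = S" "distinct xs"
    using finite_distinct_list[OF S(1)] by blast
  define n where "n = length xs"
  have "\<forall>s\<in>S. \<exists>c. z * s = (\<Sum>t\<in>S. of_int (c t) * t)"
    using z unfolding stabilizes_def int_span_def by blast
  then obtain C :: "complex \<Rightarrow> complex \<Rightarrow> int"
    where C: "\<And>s. s \<in> S \<Longrightarrow> z * s = (\<Sum>t\<in>S. of_int (C s t) * t)"
    by metis
  define M where "M = mat n n (\<lambda>(i, j). C (xs ! i) (xs ! j))"
  define v where "v = vec n (\<lambda>i. xs ! i)"
  have M: "M \<in> carrier_mat n n" unfolding M_def by simp
  have M': "(map_mat of_int M :: complex mat) \<in> carrier_mat n n" using M by simp
  have sum_eq: "(\<Sum>t\<in>S. f t) = (\<Sum>j<n. f (xs ! j))" for f :: "complex \<Rightarrow> complex"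
    using sum_list_distinct_conv_sum_set[OF xs(2), of f] xs(1)
    by (simp add: n_def sum_list_sum_nth atLeast0LessThan)
  have "map_mat of_int M *\<^sub>v v = z \<cdot>\<^sub>v v"
  proof (rule eq_vecI)
    fix i assume i: "i < dim_vec (z \<cdot>\<^sub>v v)"
    hence i': "i < n" by (simp add: v_def)
    hence "xs ! i \<in> S" using xs n_def by auto
    hence "z * (xs ! i) = (\<Sum>j<n. of_int (C (xs ! i) (xs ! j)) * (xs ! j))"
      using C sum_eq by simp
    thus "(map_mat of_int M *\<^sub>v v) $ i = (z \<cdot>\<^sub>v v) $ i"
      using i' by (simp add: M_def v_def scalar_prod_def atLeast0LessThan)
  qed (simp add: M_def v_def)
  moreover have "v \<noteq> 0\<^sub>v n"
  proof
    assume v0: "v = 0\<^sub>v n"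
    obtain i where "i < n" "xs ! i = 1"
      using S(2) xs n_def by (metis in_set_conv_nth)
    thus False using arg_cong[OF v0, of "\<lambda>v. v $ i"] by (simp add: v_def)
  qed
  ultimately have "eigenvalue (map_mat of_int M :: complex mat) z"
    unfolding eigenvalue_def eigenvector_def using M by (intro exI[of _ v]) (auto simp: v_def)
  hence "poly (map_poly of_int (char_poly M)) z = 0"
    using eigenvalue_root_char_poly[OF M'] of_int_hom.char_poly_hom[OF M, where 'a = complex] by simp
  moreover have "lead_coeff (char_poly M) = 1"
    using degree_monic_char_poly[OF M] by simp
  ultimately show ?thesis
    unfolding algebraic_int_altdef_ipoly by blast
qed

text \<open>The products \<open>s * z ^ i\<close> with \<open>i < n\<close> generate a group stable
  under \<open>z\<close>: only the top power overflows, and the relation for \<open>z ^ n\<close>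
  brings it back, its coefficients being absorbed by \<open>S\<close>. Old stabilizers survive, so
  the step can be iterated.\<close>

lemma stabilized_extend:
  assumes S: "finite S" "1 \<in> S" and c: "\<And>i. i < n \<Longrightarrow> stabilizes (c i) S"
    and z: "z ^ n = (\<Sum>i<n. c i * z ^ i)"
  obtains S' where "finite S'" "1 \<in> S'" "stabilizes z S'" "\<And>x. stabilizes x S \<Longrightarrow> stabilizes x S'"
proof -
  define S' where "S' = (\<lambda>(s, i). s * z ^ i) ` (S \<times> {..<n})"
  \<comment> \<open>For \<open>n = 0\<close> the relation would read \<open>1 = 0\<close>. Hence the
    power \<open>z ^ 0\<close> is available and \<open>1\<close> stays in \<open>S'\<close>.\<close>
  have "n \<noteq> 0"
    using z by (cases "n = 0") auto
  have fin: "finite S'" unfolding S'_def using S by simp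
  have base: "s * z ^ i \<in> int_span S'" if "s \<in> S" "i < n" for s i
    using that by (intro int_span_base fin) (auto simp: S'_def)
  have lift: "x * z ^ i \<in> int_span S'" if "x \<in> int_span S" "i < n" for x i
    using int_span_mult[of S "z ^ i" S' x] base that by (simp add: mult.commute)
  show ?thesis
  proof (rule that[of S'])
    show "finite S'" by fact
    show "1 \<in> S'" unfolding S'_def using S(2) \<open>n \<noteq> 0\<close> by force
    show "stabilizes x S'" if "stabilizes x S" for x
      unfolding stabilizes_def
    proof
      fix s assume "s \<in> S'"
      then obtain t i where t: "t \<in> S" "i < n" "s = t * z ^ i" unfolding S'_def by auto
      have "x * t \<in> int_span S" using that t unfolding stabilizes_def by blast
      from lift[OF this t(2)] show "x * s \<in> int_span S'" by (simp add: t(3) mult.assoc)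
    qed
    show "stabilizes z S'"
      unfolding stabilizes_def
    proof
      fix s assume "s \<in> S'"
      then obtain t i where t: "t \<in> S" "i < n" "s = t * z ^ i" unfolding S'_def by auto
      show "z * s \<in> int_span S'"
      proof (cases "Suc i < n")
        case True
        thus ?thesis using base[OF t(1) True] t by (simp add: algebra_simps)
      next
        case False
        hence "n = Suc i" using t(2) by simp
        hence "z * s = t * z ^ n" using t(3) by simp
        also have "\<dots> = (\<Sum>j<n. (c j * t) * z ^ j)"
          by (simp add: z sum_distrib_left algebra_simps)
        also have "\<dots> \<in> int_span S'"
          using c t unfolding stabilizes_def by (intro int_span_sum lift) auto
        finally show ?thesis .
      qed
    qed
  qed
qed

lemma algebraic_int_power_eqE:
  assumes "algebraic_int (z :: complex)"
  obtains n c where "z ^ n = (\<Sum>i<n. of_int (c i) * z ^ i)"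
proof -
  obtain p where p: "poly (map_poly of_int p) z = 0" "lead_coeff p = 1"
    using assms unfolding algebraic_int_altdef_ipoly by blast
  have "0 = (\<Sum>i\<le>degree p. of_int (coeff p i) * z ^ i)"
    using p(1) by (simp add: poly_altdef degree_map_poly coeff_map_poly)
  also have "\<dots> = (\<Sum>i<degree p. of_int (coeff p i) * z ^ i) + z ^ degree p"
    using p(2) by (simp flip: lessThan_Suc_atMost)
  finally have "z ^ degree p = (\<Sum>i<degree p. of_int (- coeff p i) * z ^ i)"
    by (simp add: sum_negf eq_neg_iff_add_eq_0 add.commute)
  thus ?thesis by (intro that)
qed

lemma algebraic_ints_stabilize:
  assumes "finite C" "\<And>c. c \<in> C \<Longrightarrow> algebraic_int c"
  shows "\<exists>S. finite S \<and> 1 \<in> S \<and> (\<forall>c\<in>C. stabilizes c S)"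
  using assms
proof (induction C rule: finite_induct)
  case empty
  thus ?case by (intro exI[of _ "{1}"]) auto
next
  case (insert z C)
  then obtain S where S: "finite S" "1 \<in> S" "\<forall>c\<in>C. stabilizes c S" by auto
  obtain n c where "z ^ n = (\<Sum>i<n. of_int (c i) * z ^ i)"
    using algebraic_int_power_eqE[OF insert.prems[OF insertI1]] by blast
  from stabilized_extend[OF S(1,2) stabilizes_of_int[OF S(1)] this]
  obtain S' where "finite S'" "1 \<in> S'" "stabilizes z S'" "\<And>x. stabilizes x S \<Longrightarrow> stabilizes x S'"
    by metis
  thus ?case using S(3) by blast
qed

lemma algebraic_int_add:
  assumes "algebraic_int (x :: complex)" "algebraic_int y"
  shows "algebraic_int (x + y)"
  using algebraic_ints_stabilize[of "{x, y}"] assms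
  by (auto intro: stabilizes_imp_algebraic_int stabilizes_add)

lemma algebraic_int_mult:
  assumes "algebraic_int (x :: complex)" "algebraic_int y"
  shows "algebraic_int (x * y)"
  using algebraic_ints_stabilize[of "{x, y}"] assms
  by (auto intro: stabilizes_imp_algebraic_int stabilizes_mult)

lemma algebraic_int_diff:
  assumes "algebraic_int (x :: complex)" "algebraic_int y"
  shows "algebraic_int (x - y)"
  using algebraic_int_add[OF assms(1) algebraic_int_mult[OF algebraic_int_of_int[of "-1"] assms(2)]]
  by simp

lemma algebraic_int_power: "algebraic_int (x :: complex) \<Longrightarrow> algebraic_int (x ^ n)"
  by (induction n) (auto intro: algebraic_int_mult)

text \<open>Transitivity of integrality: a common \<open>S\<close> for the coefficients is enlarged
  to one that \<open>z\<close> stabilizes too.\<close>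

lemma algebraic_int_integral:
  assumes "\<And>i. i < n \<Longrightarrow> algebraic_int (c i)" and z: "z ^ n = (\<Sum>i<n. c i * z ^ i)"
  shows "algebraic_int (z :: complex)"
proof -
  obtain S where S: "finite S" "1 \<in> S" "\<forall>c\<in>c ` {..<n}. stabilizes c S"
    using algebraic_ints_stabilize[of "c ` {..<n}"] assms(1) by auto
  then obtain S' where "finite S'" "1 \<in> S'" "stabilizes z S'"
    using stabilized_extend[OF S(1,2) _ z] by (metis image_eqI lessThan_iff)
  thus ?thesis by (rule stabilizes_imp_algebraic_int)
qed

text \<open>Multiplying \<open>poly p z = 0\<close> by \<open>a ^ (n - 1)\<close> gives a monic
  equation for \<open>a * z\<close> whose coefficients are still integral.\<close>

lemma algebraic_int_lead_coeff_mult_root: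
  fixes p :: "complex poly"
  assumes "\<And>i. algebraic_int (coeff p i)" "poly p z = 0"
  shows "algebraic_int (lead_coeff p * z)"
proof (cases "degree p = 0")
  case True
  thus ?thesis using assms(2) by (auto elim: degree_eq_zeroE)
next
  case False
  define n a where "n = degree p" and "a = lead_coeff p"
  have n: "n > 0" using False n_def by simp
  have "0 = a ^ (n - 1) * (\<Sum>i\<le>n. coeff p i * z ^ i)"
    using assms(2) by (simp add: poly_altdef n_def)
  also have "\<dots> = a ^ (n - 1) * (\<Sum>i<n. coeff p i * z ^ i) + a ^ (n - 1) * (a * z ^ n)"
    by (simp add: a_def n_def algebra_simps flip: lessThan_Suc_atMost)
  also have "a ^ (n - 1) * (a * z ^ n) = (a * z) ^ n"
    using n by (cases n) (auto simp: power_mult_distrib)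
  also have "a ^ (n - 1) * (\<Sum>i<n. coeff p i * z ^ i) = (\<Sum>i<n. coeff p i * a ^ (n - 1 - i) * (a * z) ^ i)"
    unfolding sum_distrib_left
  proof (rule sum.cong)
    fix i assume "i \<in> {..<n}"
    hence "a ^ (n - 1) = a ^ (n - 1 - i) * a ^ i" by (simp flip: power_add)
    thus "a ^ (n - 1) * (coeff p i * z ^ i) = coeff p i * a ^ (n - 1 - i) * (a * z) ^ i"
      by (simp add: power_mult_distrib)
  qed simp
  finally have "(a * z) ^ n = (\<Sum>i<n. (- 1 * (coeff p i * a ^ (n - 1 - i))) * (a * z) ^ i)"
    by (simp add: sum_negf eq_neg_iff_add_eq_0 add.commute)
  moreover have "algebraic_int (- 1 * (coeff p i * a ^ (n - 1 - i)))" for i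
    using algebraic_int_of_int[of "-1"] assms(1) unfolding a_def
    by (intro algebraic_int_mult algebraic_int_power) auto
  ultimately show ?thesis
    unfolding a_def by (rule algebraic_int_integral[rotated]) 
qed

section \<open>The field of algebraic numbers, by clearing denominators\<close>

lemma algebraic_int_multipleE:
  assumes "algebraic (x :: complex)"
  obtains a :: int where "a \<noteq> 0" "algebraic_int (of_int a * x)"
proof -
  obtain p where p: "p \<noteq> 0" "poly (map_poly of_int p) x = 0"
    using assms by (rule algebraicE')
  have "algebraic_int (lead_coeff (map_poly of_int p) * x)"
    using p by (intro algebraic_int_lead_coeff_mult_root) (auto simp: coeff_map_poly)
  thus ?thesis using that[of "lead_coeff p"] p by (simp add: degree_map_poly coeff_map_poly)
qed

lemma algebraic_of_int_multipleD:
  assumes "algebraic (of_int a * x :: complex)" "a \<noteq> 0"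
  shows "algebraic x"
proof -
  obtain p where p: "\<And>i. coeff p i \<in> \<int>" "p \<noteq> 0" "poly p (of_int a * x) = 0"
    using assms(1) by (rule algebraicE) auto
  show ?thesis
  proof (rule algebraicI)
    show "coeff (pcompose p [:0, of_int a:]) i \<in> \<int>" for i
      using p(1) by (auto simp: coeff_pcompose_linear)
    show "pcompose p [:0, of_int a:] \<noteq> 0"
      using p(2) assms(2) by (auto simp: pcompose_eq_0_iff)
    show "poly (pcompose p [:0, of_int a:]) x = 0"
      using p(3) by (simp add: poly_pcompose mult.commute)
  qed
qed

lemma algebraic_add:
  assumes "algebraic (x :: complex)" "algebraic y"
  shows "algebraic (x + y)"
proof -
  obtain a b where a: "a \<noteq> 0" "algebraic_int (of_int a * x)" and b: "b \<noteq> 0" "algebraic_int (of_int b * y)"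
    using assms by (metis algebraic_int_multipleE)
  have "algebraic_int (of_int b * (of_int a * x) + of_int a * (of_int b * y))"
    by (intro algebraic_int_add algebraic_int_mult[OF algebraic_int_of_int] a b)
  hence "algebraic (of_int (a * b) * (x + y))"
    by (intro algebraic_int_imp_algebraic) (simp add: algebra_simps)
  thus ?thesis using a b algebraic_of_int_multipleD[of "a * b"] by simp
qed

lemma algebraic_mult:
  assumes "algebraic (x :: complex)" "algebraic y"
  shows "algebraic (x * y)"
proof -
  obtain a b where a: "a \<noteq> 0" "algebraic_int (of_int a * x)" and b: "b \<noteq> 0" "algebraic_int (of_int b * y)"
    using assms by (metis algebraic_int_multipleE)
  have "algebraic_int ((of_int a * x) * (of_int b * y))"
    by (intro algebraic_int_mult[OF a(2) b(2)])
  hence "algebraic (of_int (a * b) * (x * y))"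
    by (intro algebraic_int_imp_algebraic) (simp add: algebra_simps)
  thus ?thesis using a b algebraic_of_int_multipleD[of "a * b"] by simp
qed

lemma is_subfield_algebraic: "is_subfield {x. algebraic x}"
  unfolding is_subfield_def
  using algebraic_add algebraic_add[OF _ algebraic_minus] algebraic_mult algebraic_inverse by auto

lemma algebraic_power: "algebraic (x :: complex) \<Longrightarrow> algebraic (x ^ n)"
  by (induction n) (auto intro: algebraic_mult)

section \<open>Products of roots\<close>

text \<open>Here \<open>z\<close> itself may be non-integral; only \<open>a * z\<close> enters, with
  \<open>a\<close> the leading coefficient. Removing the top term of the quotient changes
  \<open>p\<close> by \<open>monom a (Suc n) - monom (a * z) n\<close>, which is integral, and the
  rest has smaller degree.\<close>

lemma algebraic_int_coeffs_divide_root: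
  fixes p q :: "complex poly"
  assumes "\<And>i. algebraic_int (coeff p i)" "p = [:-z, 1:] * q"
  shows "algebraic_int (coeff q i)"
  using assms
proof (induction "degree p" arbitrary: p q i rule: less_induct)
  case less
  show ?case
  proof (cases "q = 0")
    case True
    thus ?thesis by simp
  next
    case False
    define n a where "n = degree q" and "a = lead_coeff q"
    have deg: "degree p = Suc n" unfolding less.prems(2) n_def using False
      by (subst degree_mult_eq) auto
    have lc: "lead_coeff p = a" unfolding less.prems(2) a_def lead_coeff_mult by simp
    have a: "algebraic_int a" using less.prems(1) lc by metis
    have az: "algebraic_int (a * z)"
      using algebraic_int_lead_coeff_mult_root[OF less.prems(1), of z] less.prems(2) lc by simp
    define q' p' where "q' = q - monom a n" and "p' = [:-z, 1:] * q'"
    have p': "p' = p - (monom a (Suc n) - monom (a * z) n)"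
      unfolding p'_def q'_def less.prems(2)
      by (simp add: algebra_simps smult_monom monom_Suc smult_diff_right flip: minus_monom)
    have q'i: "algebraic_int (coeff q' j)" for j
    proof (cases "q' = 0")
      case nz: False
      have "degree q' < degree q"
      proof -
        have "degree q' \<le> n" "coeff q' n = 0"
          unfolding q'_def n_def a_def by (auto intro: degree_diff_le degree_monom_le)
        thus ?thesis using nz n_def by (metis le_neq_implies_less leading_coeff_0_iff)
      qed
      hence "degree p' < degree p"
        unfolding deg p'_def using nz by (subst degree_mult_eq) (auto simp: n_def)
      moreover have "algebraic_int (coeff p' k)" for k
        unfolding p' using a az less.prems(1)
        by (auto simp: algebra_simps coeff_monom intro!: algebraic_int_diff algebraic_int_add)
      ultimately show ?thesis by (rule less.hyps[OF _ _ p'_def])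
    qed simp
    have "coeff q i = coeff q' i + coeff (monom a n) i" by (simp add: q'_def)
    thus ?thesis using q'i[of i] a by (auto simp: coeff_monom intro!: algebraic_int_add)
  qed
qed

text \<open>The roots are split off one by one: a root outside \<open>U\<close> is discarded, a root
  in \<open>U\<close> is absorbed into the constant, until only the constant
  \<open>c * \<Prod>U\<close> is left.\<close>

lemma algebraic_int_mult_prod_roots:
  assumes "finite Z" "\<And>i. algebraic_int (coeff (smult c (\<Prod>z\<in>Z. [:-z, 1:])) i)" "U \<subseteq> Z"
  shows "algebraic_int (c * \<Prod>U :: complex)"
  using assms
proof (induction Z arbitrary: c U rule: finite_induct)
  case empty
  thus ?case using empty.prems(1)[of 0] by simp
next
  case (insert z Z)
  define q where "q = smult c (\<Prod>z\<in>Z. [:-z, 1:])"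
  have eq: "smult c (\<Prod>z\<in>insert z Z. [:-z, 1:]) = [:-z, 1:] * q"
    using insert.hyps by (simp add: q_def del: mult_pCons_left)
  have q: "algebraic_int (coeff q i)" for i
    using algebraic_int_coeffs_divide_root[OF insert.prems(1) eq] .
  \<comment> \<open>Both \<open>X * q\<close> and the product \<open>(X - z) * q\<close> are
    integral, so \<open>z * q\<close> is, whether or not \<open>z\<close> is.\<close>
  have "smult z q = pCons 0 q - [:-z, 1:] * q" by simp
  hence zq: "algebraic_int (coeff (smult z q) i)" for i
    using q insert.prems(1)[of i] unfolding eq
    by (cases i) (auto simp: coeff_pCons simp del: mult_pCons_left intro!: algebraic_int_diff)
  show ?case
  proof (cases "z \<in> U")
    case True
    hence U: "U - {z} \<subseteq> Z" "finite U" using insert.prems(2) insert.hyps finite_subset[of U "insert z Z"] by auto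
    have "algebraic_int (coeff (smult (z * c) (\<Prod>z\<in>Z. [:-z, 1:])) i)" for i
      using zq[of i] by (simp add: q_def mult.assoc)
    hence "algebraic_int (z * c * \<Prod>(U - {z}))"
      using U insert.IH by blast
    thus ?thesis using True U by (simp add: prod.remove[of U z] mult_ac)
  next
    case False
    thus ?thesis using insert.IH[of c U] q insert.prems(2) unfolding q_def by blast
  qed
qed

text \<open>The coefficients are signed sums of terms \<open>c * \<Prod>Y\<close>. Keeping
  \<open>c\<close> arbitrary avoids writing out symmetric functions: a new \<open>w\<close> enters
  through the two constants \<open>c\<close> and \<open>c * w\<close>.\<close>

lemma algebraic_int_coeff_prod:
  assumes "finite W" "\<And>Y. Y \<subseteq> W \<Longrightarrow> algebraic_int (c * \<Prod>Y :: complex)"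
  shows "algebraic_int (coeff (smult c (\<Prod>z\<in>W. [:-z, 1:])) i)"
  using assms
proof (induction W arbitrary: c i rule: finite_induct)
  case empty
  thus ?case using empty.prems[of "{}"] by (cases i) (auto simp: coeff_pCons)
next
  case (insert w W)
  let ?P = "\<Prod>z\<in>W. [:-z, 1:]"
  have 1: "algebraic_int (coeff (smult c ?P) j)" for j
    using insert.prems by (intro insert.IH) auto
  have 2: "algebraic_int (coeff (smult (c * w) ?P) j)" for j
  proof (rule insert.IH)
    fix Y assume Y: "Y \<subseteq> W"
    hence "w \<notin> Y" "finite Y" using insert.hyps finite_subset by auto
    thus "algebraic_int (c * w * \<Prod>Y)"
      using insert.prems[of "insert w Y"] Y by (auto simp: mult.assoc)
  qed
  have "smult c (\<Prod>z\<in>insert w W. [:-z, 1:]) = pCons 0 (smult c ?P) - smult (c * w) ?P"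
    using insert.hyps by (simp add: smult_diff_right)
  thus ?case using 1 2 by (cases i) (auto simp: coeff_pCons simp del: coeff_smult intro!: algebraic_int_diff)
qed

section \<open>Minimal polynomials over the integers\<close>

lemma int_poly_mult_eval:
  "poly (map_poly of_int (p * q)) (x :: complex) = poly (map_poly of_int p) x * poly (map_poly of_int q) x"
proof -
  have "map_poly of_int (p * q) = (map_poly of_int p * map_poly of_int q :: complex poly)"
    by (rule poly_eqI) (simp add: coeff_map_poly coeff_mult)
  thus ?thesis by simp
qed

lemma int_poly_const_root:
  assumes "poly (map_poly of_int p) (x :: complex) = 0" "degree p = 0"
  shows "p = 0"
  using assms by (auto elim!: degree_eq_zeroE simp: of_int_hom.map_poly_pCons_hom)

lemma minimal_degree_int_polyE:
  assumes "algebraic (x :: complex)"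
  obtains m where "m \<noteq> 0" "poly (map_poly of_int m) x = 0"
    "\<And>q. q \<noteq> 0 \<Longrightarrow> poly (map_poly of_int q) x = 0 \<Longrightarrow> degree m \<le> degree q"
proof -
  let ?P = "\<lambda>p::int poly. p \<noteq> 0 \<and> poly (map_poly of_int p) x = 0"
  obtain p where "?P p"
    using assms by (metis algebraicE')
  hence "?P (arg_min degree ?P)" "\<forall>q. ?P q \<longrightarrow> degree (arg_min degree ?P) \<le> degree q"
    using arg_min_nat_lemma[of ?P p degree] by auto
  thus ?thesis using that by blast
qed

text \<open>A form of Gauss's lemma. Pseudo-division by an annihilator \<open>m\<close> of least
  degree shows that \<open>m\<close> divides a non-zero integer multiple of every annihilator;
  irreducibles of Z[X] being prime, these integer factors can be stripped off.\<close>

lemma irreducible_int_poly_dvd: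
  assumes p: "irreducible p" "poly (map_poly of_int p) (x :: complex) = 0"
    and q: "poly (map_poly of_int q) x = 0"
  shows "p dvd q"
proof -
  have p0: "p \<noteq> 0" using p(1) by auto
  hence "algebraic x"
    using p(2) by (intro algebraicI[of "map_poly of_int p"]) (auto simp: coeff_map_poly)
  then obtain m where m: "m \<noteq> 0" "poly (map_poly of_int m) x = 0"
    "\<And>q. q \<noteq> 0 \<Longrightarrow> poly (map_poly of_int q) x = 0 \<Longrightarrow> degree m \<le> degree q"
    by (rule minimal_degree_int_polyE) auto
  have mult: "\<exists>a k. a \<noteq> 0 \<and> smult a q = m * k" if "poly (map_poly of_int q) x = 0" for q
  proof -
    define r where "r = pseudo_mod q m"
    obtain a k where ak: "a \<noteq> 0" "smult a q = m * k + r"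
      using pseudo_mod(1)[OF m(1)] unfolding r_def by blast
    have "r = [:a:] * q + m * (- k)" using ak(2) by simp
    hence "map_poly of_int r = map_poly of_int ([:a:] * q) + (map_poly of_int (m * (- k)) :: complex poly)"
      by (intro poly_eqI) (simp add: coeff_map_poly)
    hence "poly (map_poly of_int r) x = 0"
      using that m(2) by (simp add: int_poly_mult_eval del: mult_pCons_left mult_minus_right)
    moreover have "r = 0 \<or> degree r < degree m" unfolding r_def by (rule pseudo_mod(2)[OF m(1)])
    ultimately have "r = 0" using m(3)[of r] by linarith
    thus ?thesis using ak by auto
  qed
  have prime: "prime_elem p" using p(1) by (rule irreducible_imp_prime_poly)
  have pm: "p dvd m"
  proof -
    obtain a k where ak: "a \<noteq> 0" "smult a p = m * k" using mult[OF p(2)] by blast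
    hence "p dvd m * k" by (metis dvd_smult dvd_refl)
    hence "p dvd m \<or> p dvd k" using prime by (simp add: prime_elem_dvd_mult_iff)
    \<comment> \<open>Cancelling \<open>p\<close> would make \<open>m\<close> divide the non-zero
      constant \<open>a\<close>, but a non-zero constant has no root.\<close>
    moreover have "\<not> p dvd k"
    proof
      assume "p dvd k"
      then obtain k' where "k = p * k'" by (rule dvdE)
      hence "p * [:a:] = p * (m * k')" using ak(2) by (simp add: mult_ac)
      hence "[:a:] = m * k'" using p0 by (metis mult_left_cancel)
      hence "m dvd [:a:]" by simp
      hence "degree m = 0" using ak(1) by (metis dvd_imp_degree_le degree_pCons_0 le_zero_eq pCons_eq_0_iff)
      thus False using int_poly_const_root[OF m(2)] m(1) by blast
    qed
    ultimately show ?thesis by blast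
  qed
  obtain a k where ak: "a \<noteq> 0" "smult a q = m * k" using mult[OF q] by blast
  hence "p dvd [:a:] * q" using pm by simp
  hence "p dvd [:a:] \<or> p dvd q" using prime by (simp add: prime_elem_dvd_mult_iff del: mult_pCons_left)
  moreover have "\<not> p dvd [:a:]"
    using int_poly_const_root[OF p(2)] p0 ak(1)
    by (metis dvd_imp_degree_le degree_pCons_0 le_zero_eq pCons_eq_0_iff)
  ultimately show ?thesis by blast
qed

lemma irreducible_int_polyE:
  assumes "algebraic (x :: complex)"
  obtains p where "irreducible p" "lead_coeff p > 0" "poly (map_poly of_int p) x = 0"
proof -
  obtain m where m: "m \<noteq> 0" "poly (map_poly of_int m) x = 0"
    "\<And>q. q \<noteq> 0 \<Longrightarrow> poly (map_poly of_int q) x = 0 \<Longrightarrow> degree m \<le> degree q"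
    using assms by (rule minimal_degree_int_polyE) auto
  define p where "p = smult (sgn (lead_coeff m)) (primitive_part m)"
  have lm: "lead_coeff m = content m * lead_coeff (primitive_part m)"
    by (metis content_times_primitive_part lead_coeff_smult)
  have cpos: "content m > 0" using m(1)
    by (metis content_eq_zero_iff normalize_content abs_ge_zero normalize_int_def order_le_less)
  have p0: "p \<noteq> 0" using m(1) by (simp add: p_def sgn_0_0)
  have lp: "lead_coeff p > 0"
  proof -
    have "sgn (lead_coeff m) = sgn (lead_coeff (primitive_part m))"
      using lm cpos by (simp add: sgn_mult)
    thus ?thesis using m(1) unfolding p_def lead_coeff_smult
      by (metis leading_coeff_0_iff primitive_part_eq_0_iff sgn_mult_self_eq mult.commute 
          abs_sgn zero_less_abs_iff)
  qed
  have cont: "content p = 1"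
    using m(1) unfolding p_def by (simp add: content_primitive_part sgn_if)
  have deg: "degree p = degree m" using m(1) by (simp add: p_def sgn_0_0)
  have "m = smult (content m) (primitive_part m)" by simp
  also have "\<dots> = [:content m * sgn (lead_coeff m):] * p"
    using m(1) by (simp add: p_def mult.assoc flip: power2_eq_square) (simp add: sgn_if)
  finally have "poly (map_poly of_int [:content m * sgn (lead_coeff m):]) x * poly (map_poly of_int p) x = 0"
    using m(2) by (metis int_poly_mult_eval)
  hence px: "poly (map_poly of_int p) x = 0"
    using cpos m(1) by (simp add: of_int_hom.map_poly_pCons_hom sgn_0_0)
  have "irreducible p"
  proof (rule irreducibleI)
    show "p \<noteq> 0" by fact
    show "\<not> p dvd 1"
      using int_poly_const_root[OF px] p0 by (metis dvd_imp_degree_le degree_1 le_zero_eq one_neq_zero)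
    fix a b assume ab: "p = a * b"
    \<comment> \<open>A factor vanishing at \<open>x\<close> already has full degree, so the
      cofactor is constant and divides \<open>content p = 1\<close>.\<close>
    have *: "b dvd 1" if "p = a * b" "poly (map_poly of_int a) x = 0" for a b
    proof -
      have nz: "a \<noteq> 0" "b \<noteq> 0" using that p0 by auto
      have "degree p \<le> degree a" using m(3)[OF nz(1) that(2)] deg by simp
      hence "degree b = 0" using that(1) nz by (simp add: degree_mult_eq)
      then obtain c where c: "b = [:c:]" by (rule degree_eq_zeroE)
      hence "p = smult c a" using that by simp
      hence "normalize c * content a = 1" using cont by simp
      hence "c dvd 1" by (metis dvd_triv_left normalize_dvd_iff)
      thus ?thesis using c by (simp add: is_unit_const_poly_iff)
    qed
    have "poly (map_poly of_int a) x = 0 \<or> poly (map_poly of_int b) x = 0"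
      using px unfolding ab int_poly_mult_eval by simp
    thus "a dvd 1 \<or> b dvd 1"
      using *[of a b] *[of b a] ab by (auto simp: mult.commute)
  qed
  thus ?thesis using that lp px by blast
qed

lemma minpoly_int_eqI:
  assumes "irreducible p" "lead_coeff p > 0" "poly (map_poly of_int p) x = 0"
  shows "minpoly_int x = p"
  unfolding minpoly_int_def
proof (rule the_equality)
  fix q :: "int poly" assume q: "irreducible q \<and> lead_coeff q > 0 \<and> poly (map_poly of_int q) x = 0"
  have dvd: "p dvd q" "q dvd p"
    using assms q irreducible_int_poly_dvd by blast+
  have "lead_coeff p dvd lead_coeff q" "lead_coeff q dvd lead_coeff p"
    using dvd unfolding dvd_def by (metis lead_coeff_mult)+
  hence "lead_coeff p = lead_coeff q" using assms(2) q by (simp add: zdvd_antisym_nonneg)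
  thus "q = p" using dvd by (metis poly_dvd_antisym)
qed (use assms in blast)

lemma
  assumes "algebraic x"
  shows minpoly_int_irreducible: "irreducible (minpoly_int x)"
    and minpoly_int_lead_coeff_pos: "lead_coeff (minpoly_int x) > 0"
    and minpoly_int_root: "poly (map_poly of_int (minpoly_int x)) x = 0"
  using irreducible_int_polyE[OF assms] minpoly_int_eqI by metis+

lemma minpoly_int_nonzero: "algebraic x \<Longrightarrow> minpoly_int x \<noteq> 0"
  using minpoly_int_irreducible by fastforce

lemma minpoly_int_dvd:
  assumes "algebraic x" "poly (map_poly of_int q) x = 0"
  shows "minpoly_int x dvd q"
  using irreducible_int_poly_dvd minpoly_int_irreducible minpoly_int_root assms by blast

lemma conjugates_self: "algebraic x \<Longrightarrow> x \<in> conjugates x"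
  unfolding conjugates_def using minpoly_int_root by simp

lemma finite_conjugates: "algebraic x \<Longrightarrow> finite (conjugates x)"
  unfolding conjugates_def using minpoly_int_nonzero by (intro poly_roots_finite) auto

lemma
  assumes "algebraic x" "z \<in> conjugates x"
  shows conjugates_algebraic: "algebraic z"
    and conjugates_minpoly_int: "minpoly_int z = minpoly_int x"
proof -
  show "algebraic z"
    using assms minpoly_int_nonzero[OF assms(1)] unfolding conjugates_def
    by (intro algebraicI[of "map_poly of_int (minpoly_int x)"]) (auto simp: coeff_map_poly)
  show "minpoly_int z = minpoly_int x"
    using assms minpoly_int_irreducible minpoly_int_lead_coeff_pos unfolding conjugates_def
    by (intro minpoly_int_eqI) auto
qed

lemma conjugates_int_poly_root:
  assumes "algebraic x" "z \<in> conjugates x" "poly (map_poly of_int q) x = 0"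
  shows "poly (map_poly of_int q) z = 0"
proof -
  obtain k where "q = minpoly_int x * k"
    using minpoly_int_dvd[OF assms(1,3)] by (rule dvdE)
  thus ?thesis using assms(2) by (simp add: int_poly_mult_eval conjugates_def)
qed

text \<open>\<open>mahler\<close> multiplies over a set of roots, so it matters that all roots are
  simple. A double root would share the minimal polynomial of \<open>x\<close>, which would then
  divide its own derivative, of smaller degree.\<close>

lemma minpoly_int_factor:
  assumes "algebraic x"
  shows "map_poly of_int (minpoly_int x) =
    smult (of_int (lead_coeff (minpoly_int x))) (\<Prod>z\<in>conjugates x. [:-z, 1:])"
proof -
  let ?p = "minpoly_int x" and ?P = "map_poly of_int (minpoly_int x) :: complex poly"
  have "rsquarefree ?P"
    unfolding rsquarefree_roots
  proof (intro allI notI)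
    fix z assume z: "poly ?P z = 0 \<and> poly (pderiv ?P) z = 0"
    hence conj: "z \<in> conjugates x" by (simp add: conjugates_def)
    have "pderiv ?P = map_poly of_int (pderiv ?p)"
      by (rule poly_eqI) (simp add: coeff_pderiv coeff_map_poly)
    hence "minpoly_int z dvd pderiv ?p"
      using z conjugates_algebraic[OF assms conj] by (intro minpoly_int_dvd) auto
    hence "?p dvd pderiv ?p" using conjugates_minpoly_int[OF assms conj] by simp
    moreover have deg: "degree ?p \<noteq> 0"
      using int_poly_const_root[OF minpoly_int_root[OF assms]] minpoly_int_nonzero[OF assms] by blast
    ultimately have "degree ?p \<le> degree (pderiv ?p)"
      by (intro dvd_imp_degree_le) (auto simp: pderiv_eq_0_iff)
    thus False using deg by (simp add: degree_pderiv)
  qed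
  from complex_poly_decompose_rsquarefree[OF this]
  show ?thesis by (simp add: conjugates_def degree_map_poly coeff_map_poly)
qed

lemma rat_poly_clear_denominators:
  fixes P :: "complex poly"
  assumes "\<And>i. coeff P i \<in> \<rat>"
  shows "\<exists>c q. c \<noteq> 0 \<and> smult (of_int c) P = map_poly of_int q"
  using assms
proof (induction P)
  case 0
  show ?case by (rule exI[of _ 1], rule exI[of _ 0]) simp
next
  case (pCons a P)
  have "coeff P i \<in> \<rat>" for i using pCons.prems[of "Suc i"] by simp
  then obtain c q where cq: "c \<noteq> 0" "smult (of_int c) P = map_poly of_int q" using pCons.IH by blast
  have "a \<in> \<rat>" using pCons.prems[of 0] by simp
  then obtain u v :: int where uv: "v > 0" "a = of_int u / of_int v" by (auto elim: Rats_cases')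
  have "smult (of_int (c * v)) (pCons a P) = map_poly of_int (pCons (c * u) (smult v q))"
  proof -
    have "smult (of_int (c * v)) P = smult (of_int v) (smult (of_int c) P)" by (simp add: mult.commute)
    also have "\<dots> = map_poly of_int (smult v q)" unfolding cq(2) by (rule poly_eqI) (simp add: coeff_map_poly)
    finally show ?thesis using uv by (simp add: of_int_hom.map_poly_pCons_hom)
  qed
  moreover have "c * v \<noteq> 0" using cq uv by simp
  ultimately show ?case by blast
qed

lemma conjugates_rat_poly_root:
  assumes "algebraic x" "z \<in> conjugates x" "\<And>i. coeff P i \<in> \<rat>" "poly P x = 0"
  shows "poly P z = 0"
proof -
  obtain c q where cq: "c \<noteq> 0" "smult (of_int c) P = map_poly of_int q"
    using rat_poly_clear_denominators[OF assms(3)] by blast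
  have "poly (smult (of_int c) P) x = 0" using assms(4) by simp
  hence "poly (smult (of_int c) P) z = 0"
    unfolding cq(2) using conjugates_int_poly_root[OF assms(1,2)] by blast
  thus ?thesis using cq(1) by simp
qed

lemma mahler_pos:
  assumes "algebraic x"
  shows "mahler x > 0"
  unfolding mahler_def using minpoly_int_lead_coeff_pos[OF assms]
  by (intro mult_pos_pos prod_pos) auto

section \<open>Extension of field homomorphisms\<close>

text \<open>A ring isomorphism between subrings of the complex numbers is represented by its graph, so
  that Zorn's lemma applies to set inclusion.\<close>

definition ring_rel :: "(complex \<times> complex) set \<Rightarrow> bool" where
  "ring_rel R \<longleftrightarrow> (1, 1) \<in> R \<and>
     (\<forall>a b c d. (a, b) \<in> R \<longrightarrow> (c, d) \<in> R \<longrightarrow> (a - c, b - d) \<in> R \<and> (a * c, b * d) \<in> R) \<and>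
     (\<forall>a b. (a, b) \<in> R \<longrightarrow> (a = 0 \<longleftrightarrow> b = 0))"

definition field_rel :: "(complex \<times> complex) set \<Rightarrow> bool" where
  "field_rel R \<longleftrightarrow> ring_rel R \<and> (\<forall>a b. (a, b) \<in> R \<longrightarrow> (inverse a, inverse b) \<in> R)"

text \<open>\<open>g\<close> is \<open>f\<close> with the partial isomorphism of graph
  \<open>R\<close> applied to its coefficients; carrying both polynomials along avoids naming that
  map.\<close>

definition poly_rel :: "(complex \<times> complex) set \<Rightarrow> complex poly \<Rightarrow> complex poly \<Rightarrow> bool" where
  "poly_rel R f g \<longleftrightarrow> (\<forall>i. (coeff f i, coeff g i) \<in> R)"

context
  fixes R :: "(complex \<times> complex) set"
  assumes R: "ring_rel R"
begin

lemma ring_rel_1: "(1, 1) \<in> R"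
  and ring_rel_diff: "(a, b) \<in> R \<Longrightarrow> (c, d) \<in> R \<Longrightarrow> (a - c, b - d) \<in> R"
  and ring_rel_mult: "(a, b) \<in> R \<Longrightarrow> (c, d) \<in> R \<Longrightarrow> (a * c, b * d) \<in> R"
  and ring_rel_zero_iff: "(a, b) \<in> R \<Longrightarrow> a = 0 \<longleftrightarrow> b = 0"
  using R unfolding ring_rel_def by blast+

lemma ring_rel_0: "(0, 0) \<in> R"
  using ring_rel_diff[OF ring_rel_1 ring_rel_1] by simp

lemma ring_rel_minus: "(a, b) \<in> R \<Longrightarrow> (- a, - b) \<in> R"
  using ring_rel_diff[OF ring_rel_0, of a b] by simp

lemma ring_rel_add: "(a, b) \<in> R \<Longrightarrow> (c, d) \<in> R \<Longrightarrow> (a + c, b + d) \<in> R"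
  using ring_rel_diff[OF _ ring_rel_minus, of a b c d] by simp

lemma ring_rel_power: "(a, b) \<in> R \<Longrightarrow> (a ^ n, b ^ n) \<in> R"
  by (induction n) (auto intro: ring_rel_1 ring_rel_mult)

lemma ring_rel_sum: "(\<And>i. i \<in> I \<Longrightarrow> (f i, g i) \<in> R) \<Longrightarrow> (sum f I, sum g I) \<in> R"
  by (induction I rule: infinite_finite_induct) (auto intro: ring_rel_0 ring_rel_add)

text \<open>Single-valuedness is hidden in the clause on zeros, applied to a difference.\<close>

lemma ring_rel_unique: "(a, b) \<in> R \<Longrightarrow> (a, c) \<in> R \<Longrightarrow> b = c"
  using ring_rel_diff[of a b a c] ring_rel_zero_iff[of "a - a" "b - c"] by simp

lemma ring_rel_of_nat: "(of_nat n, of_nat n) \<in> R"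
  by (induction n) (auto intro: ring_rel_0 ring_rel_1 ring_rel_add)

lemma ring_rel_of_int: "(of_int k, of_int k) \<in> R"
  by (cases k rule: int_diff_cases) (auto intro: ring_rel_diff ring_rel_of_nat)

lemma poly_rel_const: "(a, b) \<in> R \<Longrightarrow> poly_rel R [:a:] [:b:]"
  unfolding poly_rel_def by (auto simp: coeff_pCons intro: ring_rel_0 split: nat.splits)

lemma poly_rel_X: "poly_rel R [:0, 1:] [:0, 1:]"
  unfolding poly_rel_def by (auto simp: coeff_pCons intro: ring_rel_0 ring_rel_1 split: nat.splits)

lemma poly_rel_monom: "(a, b) \<in> R \<Longrightarrow> poly_rel R (monom a n) (monom b n)"
  unfolding poly_rel_def by (auto simp: coeff_monom intro: ring_rel_0)

lemma poly_rel_add: "poly_rel R f g \<Longrightarrow> poly_rel R h k \<Longrightarrow> poly_rel R (f + h) (g + k)"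
  unfolding poly_rel_def by (auto intro: ring_rel_add)

lemma poly_rel_diff: "poly_rel R f g \<Longrightarrow> poly_rel R h k \<Longrightarrow> poly_rel R (f - h) (g - k)"
  unfolding poly_rel_def by (auto intro: ring_rel_diff)

lemma poly_rel_mult: "poly_rel R f g \<Longrightarrow> poly_rel R h k \<Longrightarrow> poly_rel R (f * h) (g * k)"
  unfolding poly_rel_def coeff_mult by (auto intro: ring_rel_sum ring_rel_mult)

lemma poly_rel_coeff_0_iff: "poly_rel R f g \<Longrightarrow> coeff f i = 0 \<longleftrightarrow> coeff g i = 0"
  unfolding poly_rel_def by (auto dest: ring_rel_zero_iff)

lemma poly_rel_0_iff: "poly_rel R f g \<Longrightarrow> f = 0 \<longleftrightarrow> g = 0"
  using poly_rel_coeff_0_iff by (simp add: poly_eq_iff)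

lemma poly_rel_degree: "poly_rel R f g \<Longrightarrow> degree f = degree g"
  unfolding degree_def by (simp add: poly_rel_coeff_0_iff)

lemma poly_rel_int_poly: "poly_rel R (map_poly of_int p) (map_poly of_int p)"
  unfolding poly_rel_def by (simp add: coeff_map_poly ring_rel_of_int)

text \<open>Long division runs on both sides in step: related leading coefficients have related
  quotients, so each elimination step keeps the remainders related.\<close>

lemma poly_rel_division:
  assumes inv: "\<And>a b. (a, b) \<in> R \<Longrightarrow> (inverse a, inverse b) \<in> R"
    and h: "poly_rel R h k" "h \<noteq> 0" and f: "poly_rel R f g"
  shows "\<exists>q q' r r'. poly_rel R q q' \<and> poly_rel R r r' \<and> f = q * h + r \<and> g = q' * k + r' \<and>
    (r = 0 \<or> degree r < degree h)"
  using f
proof (induction "degree f" arbitrary: f g rule: less_induct)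
  case less
  show ?case
  proof (cases "f = 0 \<or> degree f < degree h")
    case True
    have "poly_rel R 0 0" using poly_rel_const[OF ring_rel_0] by simp
    thus ?thesis using True less.prems by (intro exI[of _ 0] exI[of _ f] exI[of _ g]) auto
  next
    case False
    define a b where "a = lead_coeff f * inverse (lead_coeff h)"
      and "b = lead_coeff g * inverse (lead_coeff k)"
    define n where "n = degree f - degree h"
    note deg = poly_rel_degree[OF less.prems] poly_rel_degree[OF h(1)]
    have "(lead_coeff f, lead_coeff g) \<in> R" "(lead_coeff h, lead_coeff k) \<in> R"
      using less.prems h(1) deg unfolding poly_rel_def by simp_all
    hence ab: "(a, b) \<in> R" unfolding a_def b_def
      by (intro ring_rel_mult inv)
    define f' g' where "f' = f - monom a n * h" and "g' = g - monom b n * k"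
    have rel: "poly_rel R f' g'" unfolding f'_def g'_def
      by (intro poly_rel_diff poly_rel_mult poly_rel_monom ab less.prems h(1))
    have a0: "a \<noteq> 0" using False h(2) by (simp add: a_def)
    have degm: "degree (monom a n * h) = degree f"
      using a0 h(2) False by (simp add: degree_mult_eq degree_monom_eq n_def)
    have "lead_coeff (monom a n * h) = lead_coeff f"
      unfolding lead_coeff_mult using h(2) a0 by (simp add: degree_monom_eq a_def)
    hence "coeff f' (degree f) = 0" unfolding f'_def using degm by simp
    moreover have "degree f' \<le> degree f" unfolding f'_def using degm by (intro degree_diff_le) auto
    ultimately have "f' = 0 \<or> degree f' < degree f"
      by (metis le_neq_implies_less leading_coeff_0_iff)
    hence "\<exists>q q' r r'. poly_rel R q q' \<and> poly_rel R r r' \<and> f' = q * h + r \<and> g' = q' * k + r' \<and>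
      (r = 0 \<or> degree r < degree h)"
    proof
      assume "f' = 0"
      hence "g' = 0" using poly_rel_0_iff[OF rel] by simp
      have "poly_rel R 0 0" using poly_rel_const[OF ring_rel_0] by simp
      thus ?thesis using \<open>f' = 0\<close> \<open>g' = 0\<close> by (intro exI[of _ 0]) auto
    next
      assume "degree f' < degree f"
      thus ?thesis using less.hyps rel by blast
    qed
    then obtain q q' r r' where *: "poly_rel R q q'" "poly_rel R r r'" "f' = q * h + r"
      "g' = q' * k + r'" "r = 0 \<or> degree r < degree h" by blast
    have "poly_rel R (q + monom a n) (q' + monom b n)"
      by (intro poly_rel_add * poly_rel_monom ab)
    moreover have "f = (q + monom a n) * h + r" "g = (q' + monom b n) * k + r'"
      using *(3,4) unfolding f'_def g'_def by (simp_all add: algebra_simps)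
    ultimately show ?thesis using *(2,5) by blast
  qed
qed

end

section \<open>Adjoining one element to a partial isomorphism\<close>

definition ext_rel :: "(complex \<times> complex) set \<Rightarrow> complex \<Rightarrow> complex \<Rightarrow> (complex \<times> complex) set" where
  "ext_rel R x y = {(poly f x, poly g y) | f g. poly_rel R f g}"

lemma ext_relI: "poly_rel R f g \<Longrightarrow> (poly f x, poly g y) \<in> ext_rel R x y"
  unfolding ext_rel_def by blast

lemma ext_rel_subset:
  assumes "ring_rel R"
  shows "R \<subseteq> ext_rel R x y"
proof safe
  fix a b assume "(a, b) \<in> R"
  from ext_relI[OF poly_rel_const[OF assms this], of x y] show "(a, b) \<in> ext_rel R x y" by simp
qed

lemma ext_rel_mem: "ring_rel R \<Longrightarrow> (x, y) \<in> ext_rel R x y"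
  using ext_relI[OF poly_rel_X, of R x y] by simp

text \<open>Polynomial arithmetic gives the closure properties for any \<open>y\<close>; the
  hypothesis \<open>iff\<close> is the remaining zero clause and makes \<open>x\<close> to
  \<open>y\<close> well defined and injective.\<close>

lemma ring_rel_ext_relI:
  assumes R: "ring_rel R" and iff: "\<And>f g. poly_rel R f g \<Longrightarrow> poly f x = 0 \<longleftrightarrow> poly g y = 0"
  shows "ring_rel (ext_rel R x y)"
  unfolding ring_rel_def
proof (intro conjI allI impI)
  show "(1, 1) \<in> ext_rel R x y" using ext_rel_subset[OF R] ring_rel_1[OF R] by blast
next
  fix a b c d assume "(a, b) \<in> ext_rel R x y" "(c, d) \<in> ext_rel R x y"
  then obtain f g h k where *: "a = poly f x" "b = poly g y" "poly_rel R f g"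
    "c = poly h x" "d = poly k y" "poly_rel R h k"
    unfolding ext_rel_def by blast
  show "(a - c, b - d) \<in> ext_rel R x y"
    using ext_relI[OF poly_rel_diff[OF R *(3,6)], of x y] * by simp
  show "(a * c, b * d) \<in> ext_rel R x y"
    using ext_relI[OF poly_rel_mult[OF R *(3,6)], of x y] * by simp
next
  fix a b assume "(a, b) \<in> ext_rel R x y"
  then obtain f g where "a = poly f x" "b = poly g y" "poly_rel R f g"
    unfolding ext_rel_def by blast
  thus "a = 0 \<longleftrightarrow> b = 0" using iff by simp
qed

text \<open>\<open>f\<close> acts as minimal polynomial of \<open>x\<close> over the domain of
  \<open>R\<close>, without being made monic, and \<open>g\<close> is its image.\<close>

definition min_rel :: "(complex \<times> complex) set \<Rightarrow> complex \<Rightarrow> complex poly \<Rightarrow> complex poly \<Rightarrow> bool" where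
  "min_rel R x f g \<longleftrightarrow> poly_rel R f g \<and> f \<noteq> 0 \<and> poly f x = 0 \<and>
     (\<forall>h k. poly_rel R h k \<longrightarrow> h \<noteq> 0 \<longrightarrow> poly h x = 0 \<longrightarrow> degree f \<le> degree h)"

lemma min_rel_exists:
  assumes "poly_rel R f g" "f \<noteq> 0" "poly f x = 0"
  shows "\<exists>f g. min_rel R x f g"
proof -
  let ?P = "\<lambda>h. h \<noteq> 0 \<and> poly h x = 0 \<and> (\<exists>k. poly_rel R h k)"
  have "?P f" using assms by blast
  then obtain h where "?P h" "\<forall>h'. ?P h' \<longrightarrow> degree h \<le> degree h'"
    using ex_has_least_nat[of ?P f degree] by blast
  thus ?thesis unfolding min_rel_def by blast
qed

lemma min_rel_exists_algebraic:
  assumes "ring_rel R" "algebraic x"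
  shows "\<exists>f g. min_rel R x f g"
proof -
  obtain p where "p \<noteq> 0" "poly (map_poly of_int p) x = 0" using assms(2) by (rule algebraicE')
  thus ?thesis by (intro min_rel_exists[OF poly_rel_int_poly[OF assms(1)]]) auto
qed

lemma min_rel_degree_pos: "min_rel R x f g \<Longrightarrow> degree f > 0"
  unfolding min_rel_def by (auto elim!: degree_eq_zeroE intro!: Nat.gr0I)

lemma poly_rel_root_transfer:
  assumes R: "field_rel R" and min: "min_rel R x f0 g0" and y: "poly g0 y = 0"
    and fg: "poly_rel R f g"
  shows "poly f x = 0 \<longleftrightarrow> poly g y = 0"
proof
  have R': "ring_rel R" and inv: "\<And>a b. (a, b) \<in> R \<Longrightarrow> (inverse a, inverse b) \<in> R"
    using R unfolding field_rel_def by auto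
  have f0: "poly_rel R f0 g0" "f0 \<noteq> 0" "poly f0 x = 0"
    and least: "\<And>h k. poly_rel R h k \<Longrightarrow> h \<noteq> 0 \<Longrightarrow> poly h x = 0 \<Longrightarrow> degree f0 \<le> degree h"
    using min unfolding min_rel_def by auto
  show "poly g y = 0" if "poly f x = 0"
  proof -
    obtain q q' r r' where *: "poly_rel R r r'" "f = q * f0 + r" "g = q' * g0 + r'"
      "r = 0 \<or> degree r < degree f0"
      using poly_rel_division[OF R' inv f0(1,2) fg] by blast
    have "poly r x = 0" using *(2) f0(3) that by simp
    hence "r = 0" using least[OF *(1)] *(4) by linarith
    hence "r' = 0" using poly_rel_0_iff[OF R' *(1)] by simp
    thus ?thesis using *(3) y by simp
  qed
  show "poly f x = 0" if gy: "poly g y = 0"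
  proof (rule ccontr)
    assume nz: "poly f x \<noteq> 0"
    \<comment> \<open>\<open>g0\<close> is not yet known to be of least degree for \<open>y\<close>,
      so a least pair \<open>f1\<close>, \<open>g1\<close> is chosen on that side. It divides both
      \<open>f\<close> and \<open>f0\<close>; as \<open>f1\<close> does not vanish at
      \<open>x\<close>, minimality of \<open>f0\<close> forces it to be constant.\<close>
    let ?P = "\<lambda>k. k \<noteq> 0 \<and> poly k y = 0 \<and> (\<exists>h. poly_rel R h k)"
    have g0: "g0 \<noteq> 0" using f0 poly_rel_0_iff[OF R'] by blast
    hence "?P g0" using f0(1) y by blast
    then obtain f1 g1 where f1: "poly_rel R f1 g1" "g1 \<noteq> 0" "poly g1 y = 0"
      and least1: "\<And>h k. poly_rel R h k \<Longrightarrow> k \<noteq> 0 \<Longrightarrow> poly k y = 0 \<Longrightarrow> degree g1 \<le> degree k"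
      using ex_has_least_nat[of ?P g0 degree] by blast
    have f1nz: "f1 \<noteq> 0" using poly_rel_0_iff[OF R' f1(1)] f1(2) by blast
    have divides: "\<exists>q q'. poly_rel R q q' \<and> h = q * f1" if hk: "poly_rel R h k" "poly k y = 0" for h k
    proof -
      obtain q q' r r' where *: "poly_rel R q q'" "poly_rel R r r'" "h = q * f1 + r" "k = q' * g1 + r'"
        "r = 0 \<or> degree r < degree f1"
        using poly_rel_division[OF R' inv f1(1) f1nz hk(1)] by blast
      have "poly r' y = 0" using *(4) f1(3) hk(2) by simp
      hence "r' = 0 \<or> degree g1 \<le> degree r'" using least1[OF *(2)] by blast
      hence "r = 0"
        using *(5) poly_rel_degree[OF R' *(2)] poly_rel_degree[OF R' f1(1)] poly_rel_0_iff[OF R' *(2)]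
        by linarith
      thus ?thesis using * by auto
    qed
    obtain q q' where q: "poly_rel R q q'" "f0 = q * f1" using divides[OF f0(1) y] by blast
    have "poly f1 x \<noteq> 0" using divides[OF fg gy] nz by auto
    hence "poly q x = 0" using f0(3) q(2) by simp
    moreover have "q \<noteq> 0" using q(2) f0(2) by auto
    ultimately have "degree f0 \<le> degree q" using least[OF q(1)] by blast
    hence "degree f1 = 0" using q(2) \<open>q \<noteq> 0\<close> f1nz by (simp add: degree_mult_eq)
    hence "degree g1 = 0" using poly_rel_degree[OF R' f1(1)] by simp
    thus False using f1(2,3) by (auto elim!: degree_eq_zeroE)
  qed
qed

section \<open>Maximal partial isomorphisms, by Zorn's lemma\<close>

lemma maximal_ring_rel_exists:
  assumes "ring_rel R"
  obtains M where "R \<subseteq> M" "ring_rel M" "\<And>N. ring_rel N \<Longrightarrow> M \<subseteq> N \<Longrightarrow> N = M"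
proof -
  let ?A = "{M. R \<subseteq> M \<and> ring_rel M}"
  have "\<exists>M\<in>?A. \<forall>X\<in>?A. M \<subseteq> X \<longrightarrow> X = M"
  proof (rule subset_Zorn_nonempty)
    show "?A \<noteq> {}" using assms by blast
    fix C assume C: "C \<noteq> {}" "subset.chain ?A C"
    have sub: "ring_rel X" "R \<subseteq> X" if "X \<in> C" for X
      using C(2) that unfolding subset.chain_def by auto
    have total: "X \<subseteq> Y \<or> Y \<subseteq> X" if "X \<in> C" "Y \<in> C" for X Y
      using C(2) that unfolding subset.chain_def by blast
    have "ring_rel (\<Union>C)"
      unfolding ring_rel_def
    proof (intro conjI allI impI)
      show "(1, 1) \<in> \<Union>C" using C(1) sub ring_rel_1 by blast
    next
      fix a b c d assume "(a, b) \<in> \<Union>C" "(c, d) \<in> \<Union>C"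
      then obtain X where X: "X \<in> C" "(a, b) \<in> X" "(c, d) \<in> X" using total by blast
      show "(a - c, b - d) \<in> \<Union>C" using ring_rel_diff[OF sub(1)[OF X(1)] X(2,3)] X(1) by blast
      show "(a * c, b * d) \<in> \<Union>C" using ring_rel_mult[OF sub(1)[OF X(1)] X(2,3)] X(1) by blast
    next
      fix a b assume "(a, b) \<in> \<Union>C"
      thus "a = 0 \<longleftrightarrow> b = 0" using sub(1) ring_rel_zero_iff by blast
    qed
    thus "\<Union>C \<in> ?A" using C(1) sub(2) by blast
  qed
  then obtain M where M: "R \<subseteq> M" "ring_rel M" "\<forall>X\<in>?A. M \<subseteq> X \<longrightarrow> X = M" by blast
  hence "\<And>N. ring_rel N \<Longrightarrow> M \<subseteq> N \<Longrightarrow> N = M" by blast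
  thus ?thesis using that M(1,2) by blast
qed

text \<open>Localizing at the powers of \<open>a\<close> and \<open>b\<close> yields a partial
  isomorphism containing \<open>M\<close>; by maximality nothing new was added, so the inverses were
  already there.\<close>

lemma maximal_ring_rel_field_rel:
  assumes M: "ring_rel M" and max: "\<And>N. ring_rel N \<Longrightarrow> M \<subseteq> N \<Longrightarrow> N = M"
  shows "field_rel M"
  unfolding field_rel_def
proof (intro conjI allI impI M)
  fix a b assume ab: "(a, b) \<in> M"
  show "(inverse a, inverse b) \<in> M"
  proof (cases "a = 0")
    case True
    thus ?thesis using ab ring_rel_zero_iff[OF M ab] by simp
  next
    case False
    hence b: "b \<noteq> 0" using ring_rel_zero_iff[OF M ab] by simp
    define N where "N = {(u / a ^ n, v / b ^ n) | u v n. (u, v) \<in> M}"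
    have NI: "(u / a ^ n, v / b ^ n) \<in> N" if "(u, v) \<in> M" for u v n
      unfolding N_def using that by blast
    have sub: "M \<subseteq> N" using NI[of _ _ 0] by auto
    have "ring_rel N"
      unfolding ring_rel_def
    proof (intro conjI allI impI)
      show "(1, 1) \<in> N" using sub ring_rel_1[OF M] by blast
    next
      fix c d e f assume "(c, d) \<in> N" "(e, f) \<in> N"
      then obtain u v n u' v' m where *: "c = u / a ^ n" "d = v / b ^ n" "(u, v) \<in> M"
        "e = u' / a ^ m" "f = v' / b ^ m" "(u', v') \<in> M"
        unfolding N_def by blast
      have "(u * a ^ m - u' * a ^ n, v * b ^ m - v' * b ^ n) \<in> M"
        using * ab by (intro ring_rel_diff[OF M] ring_rel_mult[OF M] ring_rel_power[OF M])
      from NI[OF this, of "n + m"] show "(c - e, d - f) \<in> N"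
        using False b unfolding * by (simp add: field_simps power_add)
      have "(u * u', v * v') \<in> M" using * by (intro ring_rel_mult[OF M])
      from NI[OF this, of "n + m"] show "(c * e, d * f) \<in> N"
        unfolding * by (simp add: power_add)
    next
      fix c d assume "(c, d) \<in> N"
      thus "c = 0 \<longleftrightarrow> d = 0" using False b ring_rel_zero_iff[OF M] unfolding N_def by auto
    qed
    hence "N = M" using max sub by blast
    thus ?thesis using NI[OF ring_rel_1[OF M], of 1] by (simp add: inverse_eq_divide)
  qed
qed

text \<open>The image of the minimal polynomial of \<open>x\<close> has a complex root
  \<open>y\<close>, and sending \<open>x\<close> to \<open>y\<close> extends \<open>M\<close>, which
  by maximality already contains the pair.\<close>

lemma maximal_ring_rel_algebraic:
  assumes M: "ring_rel M" and max: "\<And>N. ring_rel N \<Longrightarrow> M \<subseteq> N \<Longrightarrow> N = M" and "algebraic x"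
  shows "\<exists>y. (x, y) \<in> M"
proof -
  obtain f g where min: "min_rel M x f g" using min_rel_exists_algebraic[OF M assms(3)] by blast
  have "degree g > 0"
    using min_rel_degree_pos[OF min] poly_rel_degree[OF M] min unfolding min_rel_def by metis
  then obtain y where y: "poly g y = 0"
    using fundamental_theorem_of_algebra[of g] by (auto simp: constant_degree)
  have "field_rel M" using maximal_ring_rel_field_rel[OF M max] .
  hence "ring_rel (ext_rel M x y)"
    by (intro ring_rel_ext_relI M poly_rel_root_transfer[OF _ min y])
  hence "ext_rel M x y = M" using max ext_rel_subset[OF M] by blast
  thus ?thesis using ext_rel_mem[OF M] by blast
qed

text \<open>Stands for an element of the absolute Galois group of the rationals. Values at
  transcendental arguments are left unconstrained; bijectivity on the algebraic numbers is derived
  in \<open>alg_hom_inverse_exists\<close>.\<close>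

definition alg_hom :: "(complex \<Rightarrow> complex) \<Rightarrow> bool" where
  "alg_hom \<sigma> \<longleftrightarrow> \<sigma> 1 = 1 \<and> (\<forall>a b. algebraic a \<longrightarrow> algebraic b \<longrightarrow>
     \<sigma> (a + b) = \<sigma> a + \<sigma> b \<and> \<sigma> (a * b) = \<sigma> a * \<sigma> b)"

lemma ring_rel_extends_to_alg_hom:
  assumes "ring_rel R"
  obtains \<sigma> where "alg_hom \<sigma>" "\<And>a b. algebraic a \<Longrightarrow> (a, b) \<in> R \<Longrightarrow> \<sigma> a = b"
proof -
  obtain M where M: "R \<subseteq> M" "ring_rel M" "\<And>N. ring_rel N \<Longrightarrow> M \<subseteq> N \<Longrightarrow> N = M"
    using assms by (rule maximal_ring_rel_exists) blast
  define \<sigma> where "\<sigma> = (\<lambda>x. SOME y. (x, y) \<in> M)"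
  have mem: "(x, \<sigma> x) \<in> M" if "algebraic x" for x
    unfolding \<sigma>_def using maximal_ring_rel_algebraic[OF M(2,3) that] by (rule someI_ex)
  have eq: "\<sigma> x = y" if "algebraic x" "(x, y) \<in> M" for x y
    using ring_rel_unique[OF M(2) mem] that by blast
  have "alg_hom \<sigma>"
    unfolding alg_hom_def
    by (auto intro!: eq mem ring_rel_1[OF M(2)] ring_rel_add[OF M(2)] ring_rel_mult[OF M(2)]
        algebraic_add algebraic_mult)
  thus ?thesis using that eq M(1) by blast
qed

text \<open>Over \<open>F\<close> the minimal polynomial of \<open>x\<close> has degree at least 2
  and \<open>x\<close> is a simple root, because the derivative has smaller degree. So there is
  another root \<open>y\<close>, and the identity on \<open>F\<close> extends by sending
  \<open>x\<close> to \<open>y\<close>.\<close>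

lemma alg_hom_moves:
  assumes F: "is_subfield F" and x: "algebraic x" "x \<notin> F"
  obtains \<sigma> where "alg_hom \<sigma>" "\<And>a. algebraic a \<Longrightarrow> a \<in> F \<Longrightarrow> \<sigma> a = a" "\<sigma> x \<noteq> x"
proof -
  define R where "R = Id_on F"
  have inv: "inverse a \<in> F" if "a \<in> F" for a
    using F that unfolding is_subfield_def by (cases "a = 0") auto
  have R: "ring_rel R" "field_rel R"
    using F inv unfolding field_rel_def ring_rel_def R_def is_subfield_def by (auto simp: Id_on_iff)
  obtain f g where min: "min_rel R x f g" using min_rel_exists_algebraic[OF R(1) x(1)] by blast
  have "g = f" using min unfolding min_rel_def poly_rel_def R_def
    by (auto intro!: poly_eqI simp: Id_on_iff)
  note min = min[unfolded \<open>g = f\<close>]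
  have f: "poly_rel R f f" "f \<noteq> 0" "poly f x = 0"
    and least: "\<And>h k. poly_rel R h k \<Longrightarrow> h \<noteq> 0 \<Longrightarrow> poly h x = 0 \<Longrightarrow> degree f \<le> degree h"
    using min unfolding min_rel_def by auto
  have pos: "degree f > 0" using min_rel_degree_pos[OF min] .
  have deg: "degree f \<noteq> 1"
  proof
    assume "degree f = 1"
    hence "poly f x = coeff f 0 + coeff f 1 * x" "coeff f 1 \<noteq> 0"
      using f(2) leading_coeff_0_iff[of f] by (simp_all add: poly_altdef)
    hence "x = (0 - coeff f 0) * inverse (coeff f 1)"
      using f(3) by (simp add: field_simps add_eq_0_iff)
    moreover have "coeff f i \<in> F" for i using f(1) unfolding poly_rel_def R_def by (auto simp: Id_on_iff)
    ultimately have "x \<in> F" using F inv unfolding is_subfield_def by metis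
    thus False using x(2) by simp
  qed
  obtain h where h: "f = [:-x, 1:] * h" using f(3) by (metis poly_eq_0_iff_dvd dvdE)
  have "poly (pderiv f) x \<noteq> 0"
  proof
    assume 0: "poly (pderiv f) x = 0"
    have "poly_rel R (pderiv f) (pderiv f)"
      using f(1) unfolding poly_rel_def coeff_pderiv
      by (intro allI ring_rel_mult[OF R(1) ring_rel_of_nat[OF R(1)]]) blast
    moreover have "pderiv f \<noteq> 0" using pos by (simp add: pderiv_eq_0_iff)
    ultimately have "degree f \<le> degree (pderiv f)" using least 0 by blast
    thus False using pos by (simp add: degree_pderiv)
  qed
  hence hx: "poly h x \<noteq> 0" unfolding h by (simp add: pderiv_mult pderiv_pCons del: mult_pCons_left)
  have "h \<noteq> 0" using f(2) h by auto
  hence "degree f = Suc (degree h)" unfolding h by (subst degree_mult_eq) auto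
  hence "degree h > 0" using pos deg by simp
  then obtain y where y: "poly h y = 0"
    using fundamental_theorem_of_algebra[of h] by (auto simp: constant_degree)
  hence "y \<noteq> x" using hx by auto
  have "ring_rel (ext_rel R x y)"
    using y by (intro ring_rel_ext_relI R poly_rel_root_transfer[OF R(2) min]) (simp add: h)
  then obtain \<sigma> where \<sigma>: "alg_hom \<sigma>" "\<And>a b. algebraic a \<Longrightarrow> (a, b) \<in> ext_rel R x y \<Longrightarrow> \<sigma> a = b"
    using ring_rel_extends_to_alg_hom by blast
  show ?thesis
  proof (rule that[OF \<sigma>(1)])
    show "\<sigma> a = a" if "algebraic a" "a \<in> F" for a
      using \<sigma>(2)[OF that(1)] that(2) ext_rel_subset[OF R(1)] unfolding R_def by blast
    show "\<sigma> x \<noteq> x" using \<sigma>(2)[OF x(1) ext_rel_mem[OF R(1)]] \<open>y \<noteq> x\<close> by simp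
  qed
qed

section \<open>Homomorphisms and conjugates\<close>

lemma is_subfieldI:
  assumes "0 \<in> F" "1 \<in> F" "\<And>a b. a \<in> F \<Longrightarrow> b \<in> F \<Longrightarrow> a + b \<in> F"
    "\<And>a b. a \<in> F \<Longrightarrow> b \<in> F \<Longrightarrow> a - b \<in> F" "\<And>a b. a \<in> F \<Longrightarrow> b \<in> F \<Longrightarrow> a * b \<in> F"
    "\<And>a. a \<in> F \<Longrightarrow> inverse a \<in> F"
  shows "is_subfield F"
  using assms unfolding is_subfield_def by simp

lemma is_subfieldD:
  assumes "is_subfield F"
  shows "0 \<in> F" "1 \<in> F" "\<And>a b. a \<in> F \<Longrightarrow> b \<in> F \<Longrightarrow> a + b \<in> F"
    "\<And>a b. a \<in> F \<Longrightarrow> b \<in> F \<Longrightarrow> a - b \<in> F" "\<And>a b. a \<in> F \<Longrightarrow> b \<in> F \<Longrightarrow> a * b \<in> F"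
    "\<And>a. a \<in> F \<Longrightarrow> inverse a \<in> F"
proof -
  note F = assms[unfolded is_subfield_def]
  show "0 \<in> F" "1 \<in> F" "\<And>a b. a \<in> F \<Longrightarrow> b \<in> F \<Longrightarrow> a + b \<in> F"
    "\<And>a b. a \<in> F \<Longrightarrow> b \<in> F \<Longrightarrow> a - b \<in> F" "\<And>a b. a \<in> F \<Longrightarrow> b \<in> F \<Longrightarrow> a * b \<in> F"
    using F by simp_all
  show "inverse a \<in> F" if "a \<in> F" for a
    using F that by (cases "a = 0") simp_all
qed

lemma algebraic_diff: "algebraic (x :: complex) \<Longrightarrow> algebraic y \<Longrightarrow> algebraic (x - y)"
  using algebraic_add[of x "- y"] by simp

lemma conjugates_eq_of_mem:
  assumes "algebraic x" "z \<in> conjugates x"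
  shows "conjugates z = conjugates x"
  using conjugates_minpoly_int[OF assms] unfolding conjugates_def by simp

context
  fixes \<sigma> :: "complex \<Rightarrow> complex"
  assumes \<sigma>: "alg_hom \<sigma>"
begin

lemma alg_hom_1: "\<sigma> 1 = 1"
  and alg_hom_add: "algebraic a \<Longrightarrow> algebraic b \<Longrightarrow> \<sigma> (a + b) = \<sigma> a + \<sigma> b"
  and alg_hom_mult: "algebraic a \<Longrightarrow> algebraic b \<Longrightarrow> \<sigma> (a * b) = \<sigma> a * \<sigma> b"
  using \<sigma> unfolding alg_hom_def by simp_all

lemma alg_hom_0: "\<sigma> 0 = 0"
  using alg_hom_add[of 0 0] by simp

lemma alg_hom_minus: "algebraic a \<Longrightarrow> \<sigma> (- a) = - \<sigma> a"
  using minus_unique[of "\<sigma> a" "\<sigma> (- a)"] alg_hom_add[of a "- a"] alg_hom_0 by simp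

lemma alg_hom_diff: "algebraic a \<Longrightarrow> algebraic b \<Longrightarrow> \<sigma> (a - b) = \<sigma> a - \<sigma> b"
  using alg_hom_add[of a "- b"] alg_hom_minus by simp

lemma alg_hom_eq_0: "algebraic a \<Longrightarrow> \<sigma> a = 0 \<Longrightarrow> a = 0"
  using alg_hom_mult[of a "inverse a"] alg_hom_1 by (cases "a = 0") auto

lemma alg_hom_inj: "algebraic a \<Longrightarrow> algebraic b \<Longrightarrow> \<sigma> a = \<sigma> b \<Longrightarrow> a = b"
  using alg_hom_eq_0[of "a - b"] algebraic_add[of a "- b"] alg_hom_diff[of a b] by simp

lemma alg_hom_inverse: "algebraic a \<Longrightarrow> \<sigma> (inverse a) = inverse (\<sigma> a)"
proof (cases "a = 0")
  case False
  assume "algebraic a"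
  hence "\<sigma> a * \<sigma> (inverse a) = 1" using alg_hom_mult[of a "inverse a"] alg_hom_1 False by auto
  thus ?thesis by (metis inverse_unique)
qed (simp add: alg_hom_0)

lemma alg_hom_power: "algebraic a \<Longrightarrow> \<sigma> (a ^ n) = \<sigma> a ^ n"
  by (induction n) (auto simp: alg_hom_1 alg_hom_mult algebraic_power)

lemma alg_hom_of_nat: "\<sigma> (of_nat n) = of_nat n"
  by (induction n) (auto simp: alg_hom_0 alg_hom_1 alg_hom_add)

lemma alg_hom_of_int: "\<sigma> (of_int k) = of_int k"
  by (cases k rule: int_diff_cases) (simp add: alg_hom_diff alg_hom_of_nat)

lemma alg_hom_int_poly:
  assumes "algebraic x"
  shows "algebraic (poly (map_poly of_int p) x)"
    and "\<sigma> (poly (map_poly of_int p) x) = poly (map_poly of_int p) (\<sigma> x)"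
  using assms
  by (induction p) (auto simp: of_int_hom.map_poly_pCons_hom alg_hom_0 alg_hom_add alg_hom_mult
      alg_hom_of_int algebraic_add algebraic_mult)

lemma alg_hom_conjugates:
  assumes "algebraic x"
  shows "\<sigma> x \<in> conjugates x"
  using alg_hom_int_poly(2)[OF assms, of "minpoly_int x"] minpoly_int_root[OF assms] alg_hom_0
  unfolding conjugates_def by simp

lemma alg_hom_algebraic: "algebraic x \<Longrightarrow> algebraic (\<sigma> x)"
  using alg_hom_conjugates conjugates_algebraic by blast

lemma alg_hom_image_eq:
  assumes "finite V" "\<And>v. v \<in> V \<Longrightarrow> algebraic v" "\<And>v. v \<in> V \<Longrightarrow> \<sigma> v \<in> V"
  shows "\<sigma> ` V = V"
proof (rule endo_inj_surj)
  show "\<sigma> ` V \<subseteq> V" using assms(3) by (rule image_subsetI)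
  show "inj_on \<sigma> V" using assms(2) alg_hom_inj by (intro inj_onI) simp
qed fact

lemma alg_hom_image_conjugates:
  assumes "algebraic x"
  shows "\<sigma> ` conjugates x = conjugates x"
proof (rule alg_hom_image_eq)
  show "finite (conjugates x)" using finite_conjugates[OF assms] .
  fix z assume z: "z \<in> conjugates x"
  show "algebraic z" using conjugates_algebraic[OF assms z] .
  thus "\<sigma> z \<in> conjugates x" using alg_hom_conjugates conjugates_eq_of_mem[OF assms z] by metis
qed

text \<open>Surjectivity on the infinite extension reduces to finite sets: \<open>\<sigma>\<close>
  permutes the conjugates of each algebraic number.\<close>

lemma alg_hom_inverse_exists:
  obtains \<tau> where "alg_hom \<tau>" "\<And>x. algebraic x \<Longrightarrow> \<tau> (\<sigma> x) = x" "\<And>x. algebraic x \<Longrightarrow> \<sigma> (\<tau> x) = x"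
proof -
  let ?A = "{x :: complex. algebraic x}"
  define \<tau> where "\<tau> = inv_into ?A \<sigma>"
  have inj: "inj_on \<sigma> ?A" by (intro inj_onI) (auto dest: alg_hom_inj)
  have surj: "y \<in> \<sigma> ` ?A" if "algebraic y" for y
  proof -
    have "y \<in> \<sigma> ` conjugates y" using conjugates_self alg_hom_image_conjugates that by blast
    thus ?thesis using conjugates_algebraic[OF that] by auto
  qed
  have 1: "\<tau> (\<sigma> x) = x" if "algebraic x" for x
    unfolding \<tau>_def using that inj by (intro inv_into_f_f) auto
  have 2: "\<sigma> (\<tau> x) = x" if "algebraic x" for x
    unfolding \<tau>_def using surj[OF that] by (rule f_inv_into_f)
  have alg: "algebraic (\<tau> x)" if "algebraic x" for x
    unfolding \<tau>_def using inv_into_into[OF surj[OF that]] by simp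
  have "alg_hom \<tau>"
    unfolding alg_hom_def
  proof (intro conjI allI impI)
    show "\<tau> 1 = 1" using 1[of 1] alg_hom_1 by simp
    fix a b :: complex assume ab: "algebraic a" "algebraic b"
    have "\<sigma> (\<tau> a + \<tau> b) = a + b" "\<sigma> (\<tau> a * \<tau> b) = a * b"
      using ab by (simp_all add: alg_hom_add alg_hom_mult alg 2)
    thus "\<tau> (a + b) = \<tau> a + \<tau> b" "\<tau> (a * b) = \<tau> a * \<tau> b"
      using 1 ab alg algebraic_add algebraic_mult by metis+
  qed
  thus ?thesis using that 1 2 by blast
qed

lemma alg_hom_prod:
  assumes "finite V" "\<And>v. v \<in> V \<Longrightarrow> algebraic v"
  shows "algebraic (\<Prod>V)" "\<sigma> (\<Prod>V) = \<Prod>(\<sigma> ` V)"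
proof -
  have "algebraic (\<Prod>V) \<and> \<sigma> (\<Prod>V) = (\<Prod>v\<in>V. \<sigma> v)"
    using assms by (induction V rule: finite_induct) (auto simp: alg_hom_1 alg_hom_mult intro: algebraic_mult)
  moreover have "inj_on \<sigma> V" using assms(2) by (intro inj_onI) (auto dest: alg_hom_inj)
  ultimately show "algebraic (\<Prod>V)" "\<sigma> (\<Prod>V) = \<Prod>(\<sigma> ` V)"
    by (auto simp: prod.reindex)
qed

lemma alg_hom_coeff_prod:
  assumes "finite V" "\<And>v. v \<in> V \<Longrightarrow> algebraic v"
  shows "algebraic (coeff (\<Prod>v\<in>V. [:-v, 1:]) k)"
    and "\<sigma> (coeff (\<Prod>v\<in>V. [:-v, 1:]) k) = coeff (\<Prod>v\<in>\<sigma> ` V. [:-v, 1:]) k"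
proof -
  have "algebraic (coeff (\<Prod>v\<in>V. [:-v, 1:]) k) \<and>
    \<sigma> (coeff (\<Prod>v\<in>V. [:-v, 1:]) k) = coeff (\<Prod>v\<in>V. [:-\<sigma> v, 1:]) k"
    using assms
  proof (induction V arbitrary: k rule: finite_induct)
    case empty
    thus ?case by (cases k) (auto simp: coeff_pCons alg_hom_0 alg_hom_1)
  next
    case (insert v V)
    let ?P = "\<Prod>v\<in>V. [:-v, 1:]" and ?Q = "\<Prod>v\<in>V. [:-\<sigma> v, 1:]"
    have IH: "algebraic (coeff ?P k)" "\<sigma> (coeff ?P k) = coeff ?Q k" for k
      using insert.IH insert.prems by auto
    have v: "algebraic v" using insert.prems by simp
    show ?case using insert.hyps v IH
      by (cases k) (auto simp: alg_hom_diff alg_hom_mult alg_hom_minus algebraic_mult algebraic_diff coeff_pCons)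
  qed
  moreover have "inj_on \<sigma> V" using assms(2) by (intro inj_onI) (auto dest: alg_hom_inj)
  ultimately show "algebraic (coeff (\<Prod>v\<in>V. [:-v, 1:]) k)"
    "\<sigma> (coeff (\<Prod>v\<in>V. [:-v, 1:]) k) = coeff (\<Prod>v\<in>\<sigma> ` V. [:-v, 1:]) k"
    by (auto simp: prod.reindex)
qed

end

lemma alg_hom_comp:
  assumes "alg_hom \<sigma>" "alg_hom \<tau>"
  shows "alg_hom (\<sigma> \<circ> \<tau>)"
  unfolding alg_hom_def
  by (simp add: alg_hom_1[OF assms(1)] alg_hom_1[OF assms(2)] alg_hom_add[OF assms(1)]
      alg_hom_add[OF assms(2)] alg_hom_mult[OF assms(1)] alg_hom_mult[OF assms(2)]
      alg_hom_algebraic[OF assms(2)])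

lemma alg_hom_id: "alg_hom (\<lambda>x. x)"
  unfolding alg_hom_def by simp

lemma is_subfield_Rats: "is_subfield \<rat>"
  by (rule is_subfieldI) auto

lemma alg_hom_fixed_imp_Rats:
  assumes "algebraic x" "\<And>\<sigma>. alg_hom \<sigma> \<Longrightarrow> \<sigma> x = x"
  shows "x \<in> \<rat>"
proof (rule ccontr)
  assume "x \<notin> \<rat>"
  from alg_hom_moves[OF is_subfield_Rats assms(1) this]
  obtain \<sigma> where "alg_hom \<sigma>" "\<sigma> x \<noteq> x" by blast
  thus False using assms(2) by simp
qed

text \<open>The polynomial whose roots are the orbit is fixed by every homomorphism, hence rational;
  since it vanishes at \<open>x\<close>, it vanishes at all conjugates.\<close>

lemma conjugates_eq_orbit:
  assumes "algebraic x"
  shows "conjugates x = {\<sigma> x | \<sigma>. alg_hom \<sigma>}"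
proof -
  define V where "V = {\<sigma> x | \<sigma>. alg_hom \<sigma>}"
  have VI: "\<sigma> x \<in> V" if "alg_hom \<sigma>" for \<sigma> unfolding V_def using that by blast
  have VE: "\<exists>\<sigma>. alg_hom \<sigma> \<and> v = \<sigma> x" if "v \<in> V" for v using that unfolding V_def by blast
  have sub: "V \<subseteq> conjugates x" using alg_hom_conjugates assms VE by blast
  have fin: "finite V" using finite_subset[OF sub finite_conjugates[OF assms]] .
  have alg: "algebraic v" if "v \<in> V" for v using that sub conjugates_algebraic[OF assms] by blast
  have root_iff: "poly (\<Prod>v\<in>V. [:-v, 1:]) z = 0 \<longleftrightarrow> z \<in> V" for z
    using fin by (auto simp: poly_prod)
  have rat: "coeff (\<Prod>v\<in>V. [:-v, 1:]) i \<in> \<rat>" for i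
  proof (rule alg_hom_fixed_imp_Rats)
    show "algebraic (coeff (\<Prod>v\<in>V. [:-v, 1:]) i)"
      by (rule alg_hom_coeff_prod(1)[OF alg_hom_id fin alg])
    fix \<sigma> assume \<sigma>: "alg_hom \<sigma>"
    have "\<sigma> v \<in> V" if v: "v \<in> V" for v
    proof -
      obtain \<tau> where \<tau>: "alg_hom \<tau>" "v = \<tau> x" using VE[OF v] by blast
      show ?thesis using VI[OF alg_hom_comp[OF \<sigma> \<tau>(1)]] \<tau>(2) by simp
    qed
    hence "\<sigma> ` V = V" using alg_hom_image_eq[OF \<sigma> fin alg] by blast
    thus "\<sigma> (coeff (\<Prod>v\<in>V. [:-v, 1:]) i) = coeff (\<Prod>v\<in>V. [:-v, 1:]) i"
      using alg_hom_coeff_prod(2)[OF \<sigma> fin alg, of i] by simp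
  qed
  have "x \<in> V" using VI[OF alg_hom_id] .
  hence "conjugates x \<subseteq> V"
    using conjugates_rat_poly_root[OF assms _ rat] root_iff by blast
  hence "conjugates x = V" using sub by (rule subset_antisym)
  thus ?thesis unfolding V_def .
qed

section \<open>The Galois closure\<close>

lemma is_subfield_galois_closure: "is_subfield (galois_closure \<alpha>)"
  by (rule is_subfieldI) (simp_all add: galois_closure_def is_subfieldD)

lemma galois_closure_least: "is_subfield F \<Longrightarrow> conjugates \<alpha> \<subseteq> F \<Longrightarrow> galois_closure \<alpha> \<subseteq> F"
  unfolding galois_closure_def by blast

lemma conjugates_subset_galois_closure: "conjugates \<alpha> \<subseteq> galois_closure \<alpha>"
  unfolding galois_closure_def by blast

lemma galois_closure_algebraic:
  assumes "algebraic \<alpha>" "x \<in> galois_closure \<alpha>"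
  shows "algebraic x"
  using galois_closure_least[OF is_subfield_algebraic] conjugates_algebraic[OF assms(1)] assms(2)
  by blast

text \<open>Normality of the closure. The numbers mapped into it form a subfield containing the
  conjugates, so leastness applies; the next lemma does the same with the field where two
  homomorphisms agree.\<close>

lemma alg_hom_galois_closure:
  assumes \<alpha>: "algebraic \<alpha>" and \<sigma>: "alg_hom \<sigma>" and x: "x \<in> galois_closure \<alpha>"
  shows "\<sigma> x \<in> galois_closure \<alpha>"
proof -
  let ?F = "{x. algebraic x \<and> \<sigma> x \<in> galois_closure \<alpha>}"
  have "is_subfield ?F"
    by (rule is_subfieldI)
      (simp_all add: alg_hom_0[OF \<sigma>] alg_hom_1[OF \<sigma>] alg_hom_add[OF \<sigma>] alg_hom_diff[OF \<sigma>]
        alg_hom_mult[OF \<sigma>] alg_hom_inverse[OF \<sigma>] algebraic_add algebraic_diff algebraic_mult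
        algebraic_inverse is_subfieldD[OF is_subfield_galois_closure])
  moreover have "conjugates \<alpha> \<subseteq> ?F"
  proof
    fix z assume z: "z \<in> conjugates \<alpha>"
    hence "\<sigma> z \<in> conjugates \<alpha>" using alg_hom_image_conjugates[OF \<sigma> \<alpha>] imageI by metis
    thus "z \<in> ?F"
      using conjugates_algebraic[OF \<alpha> z] subsetD[OF conjugates_subset_galois_closure] by simp
  qed
  ultimately have "galois_closure \<alpha> \<subseteq> ?F" by (rule galois_closure_least)
  from subsetD[OF this x] show ?thesis by simp
qed

lemma alg_hom_eq_on_galois_closure:
  assumes \<alpha>: "algebraic \<alpha>" and \<sigma>: "alg_hom \<sigma>" and \<tau>: "alg_hom \<tau>"
    and eq: "\<And>z. z \<in> conjugates \<alpha> \<Longrightarrow> \<sigma> z = \<tau> z" and x: "x \<in> galois_closure \<alpha>"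
  shows "\<sigma> x = \<tau> x"
proof -
  let ?F = "{x. algebraic x \<and> \<sigma> x = \<tau> x}"
  have "is_subfield ?F"
    by (rule is_subfieldI)
      (simp_all add: alg_hom_0[OF \<sigma>] alg_hom_1[OF \<sigma>] alg_hom_add[OF \<sigma>] alg_hom_diff[OF \<sigma>]
        alg_hom_mult[OF \<sigma>] alg_hom_inverse[OF \<sigma>] alg_hom_0[OF \<tau>] alg_hom_1[OF \<tau>]
        alg_hom_add[OF \<tau>] alg_hom_diff[OF \<tau>] alg_hom_mult[OF \<tau>] alg_hom_inverse[OF \<tau>]
        algebraic_add algebraic_diff algebraic_mult algebraic_inverse)
  moreover have "conjugates \<alpha> \<subseteq> ?F" using conjugates_algebraic[OF \<alpha>] eq by (simp add: subset_iff)
  ultimately have "galois_closure \<alpha> \<subseteq> ?F" by (rule galois_closure_least)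
  from subsetD[OF this x] show ?thesis by simp
qed

lemma degree_minpoly_int:
  assumes "algebraic x"
  shows "degree (minpoly_int x) = card (conjugates x)"
proof -
  have "degree (minpoly_int x) = degree (map_poly of_int (minpoly_int x) :: complex poly)"
    by (simp add: degree_map_poly)
  also have "\<dots> = card (conjugates x)"
    unfolding minpoly_int_factor[OF assms] using minpoly_int_nonzero[OF assms]
    by (simp add: degree_prod_eq_sum_degree)
  finally show ?thesis .
qed

text \<open>A homomorphism is determined on the closure by its action on the conjugates of
  \<open>\<alpha>\<close>. The number of self-maps of that finite set thus bounds the number of
  conjugates of any \<open>x\<close>, in place of the field degree.\<close>

lemma degree_bounded_on_galois_closure:
  assumes \<alpha>: "algebraic \<alpha>"
  obtains D where "\<And>x. x \<in> galois_closure \<alpha> \<Longrightarrow> degree (minpoly_int x) \<le> D"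
proof -
  define A where "A = conjugates \<alpha>"
  define E where "E = (A \<rightarrow>\<^sub>E A)"
  have "finite A" unfolding A_def by (rule finite_conjugates[OF \<alpha>])
  hence finE: "finite E" unfolding E_def by (intro finite_PiE)
  have "degree (minpoly_int x) \<le> card E" if x: "x \<in> galois_closure \<alpha>" for x
  proof -
    have alg: "algebraic x" using galois_closure_algebraic[OF \<alpha> x] .
    have "\<forall>z\<in>conjugates x. \<exists>\<sigma>. alg_hom \<sigma> \<and> z = \<sigma> x"
      unfolding conjugates_eq_orbit[OF alg] by blast
    from bchoice[OF this] obtain S where S: "\<forall>z\<in>conjugates x. alg_hom (S z) \<and> z = S z x" ..
    have hom: "alg_hom (S z)" and Sx: "z = S z x" if "z \<in> conjugates x" for z
      using bspec[OF S that] by (rule conjunct1, rule conjunct2)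
    have "inj_on (\<lambda>z. restrict (S z) A) (conjugates x)"
    proof (rule inj_onI)
      fix z w assume z: "z \<in> conjugates x" and w: "w \<in> conjugates x"
        and eq: "restrict (S z) A = restrict (S w) A"
      have "S z a = S w a" if "a \<in> conjugates \<alpha>" for a
        using fun_cong[OF eq, of a] that by (simp add: A_def)
      hence "S z x = S w x" by (rule alg_hom_eq_on_galois_closure[OF \<alpha> hom[OF z] hom[OF w] _ x])
      thus "z = w" by (rule trans[OF trans[OF Sx[OF z]] Sx[OF w, symmetric]])
    qed
    moreover have "(\<lambda>z. restrict (S z) A) ` conjugates x \<subseteq> E"
    proof (rule image_subsetI)
      fix z assume "z \<in> conjugates x"
      hence "S z ` A = A" unfolding A_def by (intro alg_hom_image_conjugates hom \<alpha>)
      thus "restrict (S z) A \<in> E"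
        unfolding E_def restrict_PiE_iff using image_eqI[OF refl, of _ A "S z"] by simp
    qed
    ultimately have "card (conjugates x) \<le> card E" using finE by (rule card_inj_on_le)
    thus ?thesis using degree_minpoly_int[OF alg] by simp
  qed
  thus ?thesis by (rule that)
qed

section \<open>Descent from the radical to the Galois closure\<close>

lemma prod_max_norm_const:
  assumes "\<And>t. t \<in> T \<Longrightarrow> cmod t = r"
  shows "max 1 (cmod (\<Prod>T)) = (\<Prod>t\<in>T. max 1 (cmod t))"
proof -
  have "(\<Prod>t\<in>T. max 1 (cmod t)) = max 1 r ^ card T" using assms by simp
  moreover have "cmod (\<Prod>T) = r ^ card T" using assms by (simp flip: prod_norm)
  \<comment> \<open>Only an element of \<open>T\<close> shows that \<open>r\<close> is non-negative;
    for empty \<open>T\<close> both sides of the claim are 1.\<close>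
  moreover have "max 1 (r ^ card T) = max 1 r ^ card T" if "T \<noteq> {}"
  proof -
    from that obtain t where "t \<in> T" by blast
    from assms[OF this] have "r \<ge> 0" using norm_ge_zero[of t] by simp
    thus ?thesis
      by (cases "r \<le> 1") (simp_all add: max_absorb1 max_absorb2 power_le_one one_le_power)
  qed
  ultimately show ?thesis by (cases "T = {}") auto
qed

text \<open>The coefficients are rational, being those of a rescaled minimal polynomial, and
  integral by assumption, hence integers. The minimal polynomial divides this integer polynomial,
  and leading coefficients follow.\<close>

lemma lead_coeff_minpoly_int_dvd:
  assumes x: "algebraic x" and int: "\<And>i. algebraic_int (coeff (smult (of_int A) (\<Prod>z\<in>conjugates x. [:-z, 1:])) i)"
  shows "lead_coeff (minpoly_int x) dvd A"
proof -
  let ?P = "smult (of_int A) (\<Prod>z\<in>conjugates x. [:-z, 1:]) :: complex poly"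
  let ?a = "lead_coeff (minpoly_int x)"
  have "coeff ?P i \<in> \<int>" for i
  proof (rule rational_algebraic_int_is_int[OF int])
    have "of_int (coeff (minpoly_int x) i) = of_int ?a * coeff (\<Prod>z\<in>conjugates x. [:-z, 1:]) i"
      using arg_cong[OF minpoly_int_factor[OF x], of "\<lambda>p. coeff p i"] by (simp add: coeff_map_poly)
    hence "coeff (\<Prod>z\<in>conjugates x. [:-z, 1:]) i = of_int (coeff (minpoly_int x) i) / of_int ?a"
      using minpoly_int_nonzero[OF x] by (simp add: field_simps)
    thus "coeff ?P i \<in> \<rat>" by simp
  qed
  then obtain q where q: "?P = map_poly of_int q" by (rule intpolyE)
  have "poly ?P x = 0"
    using conjugates_self[OF x] finite_conjugates[OF x] by (auto simp: poly_prod)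
  hence "minpoly_int x dvd q" unfolding q by (rule minpoly_int_dvd[OF x])
  hence "?a dvd lead_coeff q" unfolding dvd_def by (metis lead_coeff_mult)
  moreover have "of_int (lead_coeff q) = lead_coeff ?P"
    unfolding q by (simp add: degree_map_poly coeff_map_poly)
  moreover have "lead_coeff ?P = of_int A"
    unfolding lead_coeff_smult lead_coeff_prod by simp
  ultimately show ?thesis by (metis of_int_eq_iff)
qed

lemma mahler_le_of_partition:
  assumes \<beta>: "algebraic \<beta>" and x: "algebraic x"
    and T: "\<And>w. w \<in> conjugates x \<Longrightarrow> T w \<subseteq> conjugates \<beta>"
    and disj: "\<And>w w'. w \<in> conjugates x \<Longrightarrow> w' \<in> conjugates x \<Longrightarrow> w \<noteq> w' \<Longrightarrow> T w \<inter> T w' = {}"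
    and prod: "\<And>w. w \<in> conjugates x \<Longrightarrow> \<Prod>(T w) = w"
    and norm: "\<And>w t. w \<in> conjugates x \<Longrightarrow> t \<in> T w \<Longrightarrow> cmod t = r w"
  shows "mahler x \<le> mahler \<beta>"
proof -
  let ?A = "lead_coeff (minpoly_int \<beta>)" and ?W = "conjugates x"
  have finW: "finite ?W" and fin\<beta>: "finite (conjugates \<beta>)"
    using finite_conjugates x \<beta> by auto
  have finT: "finite (T w)" if "w \<in> ?W" for w using finite_subset[OF T[OF that] fin\<beta>] .
  have "algebraic_int (coeff (smult (of_int ?A) (\<Prod>z\<in>?W. [:-z, 1:])) i)" for i
  proof (rule algebraic_int_coeff_prod[OF finW])
    fix Y assume Y: "Y \<subseteq> ?W"
    \<comment> \<open>Disjointness makes a product of conjugates of \<open>x\<close> a product of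
      distinct conjugates of \<open>\<beta>\<close>, as \<open>algebraic_int_mult_prod_roots\<close>
      requires.\<close>
    have "\<Prod>(\<Union>w\<in>Y. T w) = (\<Prod>w\<in>Y. \<Prod>(T w))"
      using Y finT disj finite_subset[OF Y finW] by (intro prod.UNION_disjoint) blast+
    also have "\<dots> = \<Prod>Y" using Y prod by (intro prod.cong) auto
    finally have *: "\<Prod>(\<Union>w\<in>Y. T w) = \<Prod>Y" .
    have "algebraic_int (of_int ?A * \<Prod>(\<Union>w\<in>Y. T w))"
    proof (rule algebraic_int_mult_prod_roots[OF fin\<beta>])
      show "algebraic_int (coeff (smult (of_int ?A) (\<Prod>z\<in>conjugates \<beta>. [:-z, 1:])) i)" for i
        unfolding minpoly_int_factor[OF \<beta>, symmetric] by (simp add: coeff_map_poly)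
      show "(\<Union>w\<in>Y. T w) \<subseteq> conjugates \<beta>" using Y T by blast
    qed
    thus "algebraic_int (of_int ?A * \<Prod>Y)" unfolding * .
  qed
  hence "lead_coeff (minpoly_int x) dvd ?A" by (rule lead_coeff_minpoly_int_dvd[OF x])
  hence le: "lead_coeff (minpoly_int x) \<le> ?A"
    using minpoly_int_lead_coeff_pos[OF \<beta>] by (rule zdvd_imp_le)
  have "(\<Prod>w\<in>?W. max 1 (cmod w)) = (\<Prod>w\<in>?W. \<Prod>t\<in>T w. max 1 (cmod t))"
  proof (rule prod.cong[OF refl])
    fix w assume w: "w \<in> ?W"
    show "max 1 (cmod w) = (\<Prod>t\<in>T w. max 1 (cmod t))"
      using prod_max_norm_const[of "T w" "r w", OF norm[OF w]] prod[OF w] by simp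
  qed
  also have "\<dots> = (\<Prod>t\<in>(\<Union>w\<in>?W. T w). max 1 (cmod t))"
    using finT disj finW by (intro prod.UNION_disjoint[symmetric]) blast+
  \<comment> \<open>Conjugates of \<open>\<beta>\<close> outside every block contribute factors at
    least 1.\<close>
  also have "\<dots> \<le> (\<Prod>t\<in>conjugates \<beta>. max 1 (cmod t))"
    using T by (intro prod_mono2 fin\<beta>) auto
  finally show ?thesis
    unfolding mahler_def using le minpoly_int_lead_coeff_pos[OF \<beta>]
    by (intro mult_mono) (auto intro: prod_nonneg)
qed

lemma radical_descent:
  assumes \<alpha>: "algebraic \<alpha>" and \<beta>: "algebraic \<beta>"
    and n: "n > 0" and \<beta>n: "\<beta> ^ n \<in> galois_closure \<alpha>"
  obtains x L where "x \<in> galois_closure \<alpha>" "L > 0" "x ^ n = \<beta> ^ (n * L)" "mahler x \<le> mahler \<beta>"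
proof -
  let ?K = "galois_closure \<alpha>"
  \<comment> \<open>\<open>H\<close> plays the Galois group over the closure, so \<open>T\<close> is
    the set of conjugates of \<open>\<beta>\<close> over it.\<close>
  define H where "H = {h. alg_hom h \<and> (\<forall>a\<in>?K. h a = a)}"
  define T where "T = (\<lambda>h. h \<beta>) ` H"
  define x where "x = \<Prod>T"
  have Hhom: "alg_hom h" "\<And>a. a \<in> ?K \<Longrightarrow> h a = a" if "h \<in> H" for h using that H_def by auto
  have Kalg: "algebraic a" if "a \<in> ?K" for a using galois_closure_algebraic[OF \<alpha> that] .
  have idH: "(\<lambda>x. x) \<in> H" using alg_hom_id H_def by simp
  have Tsub: "T \<subseteq> conjugates \<beta>" unfolding T_def
    by (rule image_subsetI) (rule alg_hom_conjugates[OF Hhom(1) \<beta>])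
  have finT: "finite T" using finite_subset[OF Tsub finite_conjugates[OF \<beta>]] .
  have Talg: "algebraic t" if "t \<in> T" for t using that Tsub conjugates_algebraic[OF \<beta>] by blast
  have \<beta>T: "\<beta> \<in> T" unfolding T_def using image_eqI[OF refl idH, of "\<lambda>h. h \<beta>"] by simp
  have Tpow: "t ^ n = \<beta> ^ n" if t: "t \<in> T" for t
  proof -
    obtain h where h: "h \<in> H" "t = h \<beta>" using t T_def by blast
    show ?thesis using alg_hom_power[OF Hhom(1)[OF h(1)] \<beta>, of n] Hhom(2)[OF h(1) \<beta>n] h(2) by simp
  qed
  have xalg: "algebraic x" and xhom: "\<And>\<sigma>. alg_hom \<sigma> \<Longrightarrow> \<sigma> x = \<Prod>(\<sigma> ` T)"
    unfolding x_def using alg_hom_prod(1)[OF alg_hom_id finT Talg] alg_hom_prod(2)[OF _ finT Talg] by auto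
  \<comment> \<open>The orbit \<open>T\<close> is stable under every homomorphism mapping \<open>\<beta>\<close> into it, because \<open>H\<close> is normal.\<close>
  have stable: "\<rho> ` T = T" if \<rho>: "alg_hom \<rho>" "\<rho> \<beta> \<in> T" for \<rho>
  proof (rule alg_hom_image_eq[OF \<rho>(1) finT Talg])
    fix t assume "t \<in> T"
    then obtain h where h: "h \<in> H" "t = h \<beta>" using T_def by blast
    obtain k where k: "k \<in> H" "\<rho> \<beta> = k \<beta>" using \<rho>(2) T_def by blast
    obtain \<rho>' where \<rho>': "alg_hom \<rho>'" "\<And>x. algebraic x \<Longrightarrow> \<rho>' (\<rho> x) = x" "\<And>x. algebraic x \<Longrightarrow> \<rho> (\<rho>' x) = x"
      using \<rho>(1) by (rule alg_hom_inverse_exists) blast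
    \<comment> \<open>Conjugating \<open>h\<close> by \<open>\<rho>\<close> keeps the closure fixed,
      since \<open>\<rho>'\<close> maps it into itself. The factor \<open>k\<close> corrects the
      starting point: \<open>k \<beta> = \<rho> \<beta>\<close>, so \<open>\<rho>'\<close> returns
      it to \<open>\<beta>\<close> and \<open>?h \<beta> = \<rho> (h \<beta>)\<close>.\<close>
    let ?h = "\<rho> \<circ> (h \<circ> (\<rho>' \<circ> k))"
    have "alg_hom ?h" by (intro alg_hom_comp \<rho>(1) \<rho>'(1) Hhom(1) h(1) k(1))
    moreover have "?h a = a" if "a \<in> ?K" for a
      using that Hhom(2)[OF h(1)] Hhom(2)[OF k(1)] alg_hom_galois_closure[OF \<alpha> \<rho>'(1)] \<rho>'(3) Kalg by simp
    ultimately have "?h \<in> H" unfolding H_def by blast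
    moreover have "\<rho> t = ?h \<beta>" using h(2) k(2) \<rho>'(2)[OF \<beta>] by simp
    ultimately show "\<rho> t \<in> T" unfolding T_def by blast
  qed auto
  have xK: "x \<in> ?K"
  proof (rule ccontr)
    assume "x \<notin> ?K"
    from alg_hom_moves[OF is_subfield_galois_closure xalg this]
    obtain \<sigma> where \<sigma>: "alg_hom \<sigma>" "\<And>a. algebraic a \<Longrightarrow> a \<in> ?K \<Longrightarrow> \<sigma> a = a" "\<sigma> x \<noteq> x" by blast
    have "\<sigma> \<in> H" unfolding H_def using \<sigma>(1,2) Kalg by blast
    hence "\<sigma> \<beta> \<in> T" unfolding T_def by blast
    hence "\<sigma> ` T = T" using stable \<sigma>(1) by blast
    thus False using xhom[OF \<sigma>(1)] \<sigma>(3) x_def by simp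
  qed
  \<comment> \<open>If two blocks meet, \<open>\<tau>' \<circ> \<sigma> \<circ> h\<close> sends
    \<open>\<beta>\<close> into \<open>T\<close> and so fixes \<open>x\<close>. As \<open>h\<close>
    fixes \<open>x\<close> too, \<open>\<sigma>\<close> and \<open>\<tau>\<close> agree at
    \<open>x\<close>.\<close>
  have same: "\<sigma> x = \<tau> x" if \<sigma>: "alg_hom \<sigma>" and \<tau>: "alg_hom \<tau>" and ne: "\<sigma> ` T \<inter> \<tau> ` T \<noteq> {}" for \<sigma> \<tau>
  proof -
    obtain s t where st: "s \<in> T" "t \<in> T" "\<sigma> s = \<tau> t" using ne by blast
    obtain h k where hk: "h \<in> H" "s = h \<beta>" "k \<in> H" "t = k \<beta>" using st T_def by blast
    obtain \<tau>' where \<tau>': "alg_hom \<tau>'" "\<And>x. algebraic x \<Longrightarrow> \<tau>' (\<tau> x) = x" "\<And>x. algebraic x \<Longrightarrow> \<tau> (\<tau>' x) = x"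
      using \<tau> by (rule alg_hom_inverse_exists) blast
    define \<rho> where "\<rho> = \<tau>' \<circ> (\<sigma> \<circ> h)"
    have \<rho>: "alg_hom \<rho>" unfolding \<rho>_def by (intro alg_hom_comp \<tau>'(1) \<sigma> Hhom(1) hk)
    have "\<rho> \<beta> = t" unfolding \<rho>_def using hk st \<tau>'(2) Talg by simp
    hence "\<rho> ` T = T" using stable[OF \<rho>] st(2) by simp
    hence "\<rho> x = x" using xhom[OF \<rho>] x_def by simp
    hence "\<tau>' (\<sigma> x) = x" unfolding \<rho>_def using Hhom(2)[OF hk(1) xK] by simp
    thus ?thesis using \<tau>'(3)[OF alg_hom_algebraic[OF \<sigma> xalg]] by simp
  qed
  have "\<forall>w\<in>conjugates x. \<exists>\<sigma>. alg_hom \<sigma> \<and> w = \<sigma> x"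
    unfolding conjugates_eq_orbit[OF xalg] by blast
  from bchoice[OF this] obtain S where S': "\<forall>w\<in>conjugates x. alg_hom (S w) \<and> w = S w x" ..
  have S: "alg_hom (S w)" "w = S w x" if "w \<in> conjugates x" for w
    using bspec[OF S' that] by (rule conjunct1, rule conjunct2)
  have "mahler x \<le> mahler \<beta>"
  proof (rule mahler_le_of_partition[OF \<beta> xalg, where T = "\<lambda>w. S w ` T" and r = "\<lambda>w. cmod (S w \<beta>)"])
    fix w assume w: "w \<in> conjugates x"
    show "S w ` T \<subseteq> conjugates \<beta>"
      using image_mono[OF Tsub, of "S w"] alg_hom_image_conjugates[OF S(1)[OF w] \<beta>] by simp
    show "\<Prod>(S w ` T) = w" using xhom[OF S(1)[OF w]] S(2)[OF w] by simp
    \<comment> \<open>All elements of \<open>T\<close> have the \<open>n\<close>-th power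
      \<open>\<beta> ^ n\<close>, so all elements of the image block share one \<open>n\<close>-th
      power.\<close>
    show "cmod t = cmod (S w \<beta>)" if "t \<in> S w ` T" for t
    proof -
      obtain u where u: "u \<in> T" "t = S w u" using \<open>t \<in> S w ` T\<close> by blast
      have "t ^ n = S w \<beta> ^ n"
        using alg_hom_power[OF S(1)[OF w] Talg[OF u(1)], of n] alg_hom_power[OF S(1)[OF w] \<beta>, of n]
          Tpow[OF u(1)] u(2) by simp
      hence "cmod t ^ n = cmod (S w \<beta>) ^ n" by (metis norm_power)
      thus ?thesis using n by (metis norm_ge_zero power_eq_imp_eq_base)
    qed
    show "S w ` T \<inter> S w' ` T = {}" if "w' \<in> conjugates x" "w \<noteq> w'" for w'
    proof (rule ccontr)
      assume "S w ` T \<inter> S w' ` T \<noteq> {}"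
      hence "S w x = S w' x" by (rule same[OF S(1)[OF w] S(1)[OF that(1)]])
      thus False using that(2) trans[OF trans[OF S(2)[OF w]] S(2)[OF that(1), symmetric]] by blast
    qed
  qed
  moreover have "x ^ n = \<beta> ^ (n * card T)"
  proof -
    have "x ^ n = (\<Prod>t\<in>T. t ^ n)" unfolding x_def by (simp add: prod_power_distrib)
    also have "\<dots> = (\<Prod>t\<in>T. \<beta> ^ n)" using Tpow by (intro prod.cong) auto
    finally show ?thesis by (simp add: power_mult)
  qed
  moreover have "card T > 0" using finT \<beta>T by (auto simp: card_gt_0_iff)
  ultimately show ?thesis using that xK by blast
qed

section \<open>Northcott's theorem\<close>

lemma norm_coeff_prod_le:
  assumes "finite V"
  shows "cmod (coeff (\<Prod>v\<in>V. [:-v, 1:]) k) \<le> (\<Prod>v\<in>V. 1 + cmod v)"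
  using assms
proof (induction V arbitrary: k rule: finite_induct)
  case empty
  thus ?case by (cases k) (auto simp: coeff_pCons)
next
  case (insert v V)
  let ?P = "\<Prod>v\<in>V. [:-v, 1:]" and ?B = "\<Prod>v\<in>V. 1 + cmod v"
  have B: "?B \<ge> 0" by (intro prod_nonneg) auto
  have 1: "cmod (v * coeff ?P k) \<le> cmod v * ?B"
    using insert.IH[of k] by (simp add: norm_mult mult_left_mono)
  have 2: "cmod (coeff (pCons 0 ?P) k) \<le> ?B" using insert.IH B by (cases k) auto
  have "coeff (\<Prod>v\<in>insert v V. [:-v, 1:]) k = coeff (pCons 0 ?P) k - v * coeff ?P k"
    using insert.hyps by simp
  also have "cmod \<dots> \<le> ?B + cmod v * ?B" using norm_triangle_ineq4 1 2 by (meson add_mono order_trans)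
  also have "\<dots> = (\<Prod>v\<in>insert v V. 1 + cmod v)" using insert.hyps by (simp add: algebra_simps)
  finally show ?case .
qed

text \<open>The power of 2 comes from \<open>1 + cmod v \<le> 2 * max 1 (cmod v)\<close>, once per
  conjugate.\<close>

lemma minpoly_int_coeff_le:
  assumes "algebraic x"
  shows "\<bar>real_of_int (coeff (minpoly_int x) k)\<bar> \<le> 2 ^ degree (minpoly_int x) * mahler x"
proof -
  let ?a = "lead_coeff (minpoly_int x)" and ?V = "conjugates x"
  have a: "?a > 0" using minpoly_int_lead_coeff_pos[OF assms] .
  have "(of_int (coeff (minpoly_int x) k) :: complex) = of_int ?a * coeff (\<Prod>z\<in>?V. [:-z, 1:]) k"
    using arg_cong[OF minpoly_int_factor[OF assms], of "\<lambda>p. coeff p k"] by (simp add: coeff_map_poly)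
  from arg_cong[OF this, of cmod]
  have "\<bar>real_of_int (coeff (minpoly_int x) k)\<bar> = of_int ?a * cmod (coeff (\<Prod>z\<in>?V. [:-z, 1:]) k)"
    using a by (simp add: norm_mult)
  also have "\<dots> \<le> of_int ?a * (\<Prod>v\<in>?V. 1 + cmod v)"
    using a by (intro mult_left_mono norm_coeff_prod_le finite_conjugates assms) auto
  also have "\<dots> \<le> of_int ?a * (\<Prod>v\<in>?V. 2 * max 1 (cmod v))"
    using a by (intro mult_left_mono prod_mono) auto
  also have "\<dots> = 2 ^ degree (minpoly_int x) * mahler x"
    by (simp add: prod.distrib degree_minpoly_int[OF assms] mahler_def)
  finally show ?thesis .
qed

lemma finite_int_polys_bounded:
  "finite {p :: int poly. degree p \<le> D \<and> (\<forall>i. \<bar>coeff p i\<bar> \<le> B)}"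
proof (rule finite_imageD)
  have "coeffs ` {p :: int poly. degree p \<le> D \<and> (\<forall>i. \<bar>coeff p i\<bar> \<le> B)}
      \<subseteq> {xs. set xs \<subseteq> {-B..B} \<and> length xs \<le> Suc D}"
    by (auto simp: coeffs_def abs_le_iff) (metis minus_le_iff)+
  thus "finite (coeffs ` {p :: int poly. degree p \<le> D \<and> (\<forall>i. \<bar>coeff p i\<bar> \<le> B)})"
    by (rule finite_subset) (simp add: finite_lists_length_le)
qed (simp add: inj_on_def coeffs_eq_iff)

text \<open>For a minimum, finitely many values are enough, and \<open>mahler x\<close> depends only
  on \<open>minpoly_int x\<close>, which has bounded degree and bounded coefficients here.\<close>

lemma finite_mahler_values:
  assumes \<alpha>: "algebraic \<alpha>"
  shows "finite {mahler x | x. x \<in> galois_closure \<alpha> \<and> mahler x \<le> C}"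
proof -
  obtain D where D: "\<And>x. x \<in> galois_closure \<alpha> \<Longrightarrow> degree (minpoly_int x) \<le> D"
    using degree_bounded_on_galois_closure[OF \<alpha>] by blast
  define B where "B = \<lceil>2 ^ D * C\<rceil>"
  let ?P = "{p :: int poly. degree p \<le> D \<and> (\<forall>i. \<bar>coeff p i\<bar> \<le> B)}"
  let ?f = "\<lambda>p. real_of_int (lead_coeff p) * (\<Prod>z\<in>{z. poly (map_poly of_int p) z = 0}. max 1 (cmod z))"
  have "{mahler x | x. x \<in> galois_closure \<alpha> \<and> mahler x \<le> C} \<subseteq> ?f ` ?P"
  proof safe
    fix x assume x: "x \<in> galois_closure \<alpha>" "mahler x \<le> C"
    have alg: "algebraic x" using galois_closure_algebraic[OF \<alpha> x(1)] .
    have "\<bar>coeff (minpoly_int x) i\<bar> \<le> B" for i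
    proof -
      have "\<bar>real_of_int (coeff (minpoly_int x) i)\<bar> \<le> 2 ^ degree (minpoly_int x) * mahler x"
        by (rule minpoly_int_coeff_le[OF alg])
      also have "\<dots> \<le> 2 ^ D * C"
        using D[OF x(1)] x(2) mahler_pos[OF alg] by (intro mult_mono power_increasing) auto
      finally show ?thesis unfolding B_def by linarith
    qed
    hence "minpoly_int x \<in> ?P" using D[OF x(1)] by blast
    moreover have "mahler x = ?f (minpoly_int x)" unfolding mahler_def conjugates_def by simp
    ultimately show "mahler x \<in> ?f ` ?P" by (rule rev_image_eqI)
  qed
  thus ?thesis using finite_int_polys_bounded by (meson finite_imageI finite_subset)
qed

section \<open>Power classes\<close>

text \<open>Ensures that \<open>Mbar_pow\<close> is never the infimum of an empty set; for
  \<open>s = a/b\<close> a \<open>b\<close>-th root of \<open>\<gamma> powi a\<close> is a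
  witness.\<close>

lemma pow_class_nonempty:
  assumes "algebraic \<gamma>" "\<gamma> \<noteq> 0"
  shows "pow_class \<gamma> s \<noteq> {}"
proof -
  obtain a b where ab: "quotient_of s = (a, b)" by fastforce
  have b: "b > 0" using quotient_of_denom_pos[OF ab] .
  define y where "y = \<gamma> powi a"
  have y: "algebraic y" "y \<noteq> 0"
    unfolding y_def using assms by (auto simp: power_int_def algebraic_power algebraic_inverse)
  obtain \<beta> where \<beta>: "\<beta> ^ nat b = y"
    using b y(2) exists_complex_root[of "nat b" y] by auto
  have "algebraic \<beta>"
    using b \<beta> by (intro algebraic_root[OF y(1), of "monom 1 (nat b)"])
      (auto simp: poly_monom degree_monom_eq coeff_monom)
  moreover have "\<beta> \<noteq> 0" using \<beta> y(2) b by auto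
  moreover have "\<beta> powi b = \<gamma> powi a" using \<beta> b y_def by (simp add: power_int_def)
  ultimately have "\<beta> \<in> pow_class \<gamma> s"
    unfolding pow_class_def using ab by (auto intro!: exI[of _ 1])
  thus ?thesis by blast
qed

lemma is_subfield_power_int:
  assumes "is_subfield F" "x \<in> F"
  shows "x powi k \<in> F"
proof -
  have pow: "y ^ n \<in> F" if "y \<in> F" for y n
    using that by (induction n) (simp_all add: is_subfieldD[OF assms(1)])
  thus ?thesis unfolding power_int_def using is_subfieldD(6)[OF assms] assms(2) by simp
qed

text \<open>\<open>in_S\<close> puts a power of \<open>\<gamma>\<close>, and hence of
  \<open>\<beta>\<close>, into the closure, which is what \<open>radical_descent\<close> asks for.
  The new exponent is \<open>s\<close> times the positive integer \<open>L\<close> found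
  there.\<close>

lemma pow_class_descent:
  assumes \<alpha>: "algebraic \<alpha>" and S: "in_S \<gamma> (galois_closure \<alpha>)"
    and s: "s \<noteq> 0" and \<beta>: "\<beta> \<in> pow_class \<gamma> s"
  obtains x r where "r \<noteq> 0" "x \<in> pow_class \<gamma> r" "x \<in> galois_closure \<alpha>" "mahler x \<le> mahler \<beta>"
proof -
  let ?K = "galois_closure \<alpha>"
  obtain a b where ab: "quotient_of s = (a, b)" by fastforce
  have b: "b > 0" using quotient_of_denom_pos[OF ab] .
  obtain m where m: "m > 0" "\<beta> powi (int m * b) = \<gamma> powi (int m * a)"
    and \<beta>0: "\<beta> \<noteq> 0" "algebraic \<beta>"
    using \<beta> ab unfolding pow_class_def by auto
  obtain \<delta> where "\<delta> \<in> rad ?K" "\<delta> \<in> pow_class \<gamma> 1" using S unfolding in_S_def by blast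
  then obtain k j where \<delta>: "\<delta> ^ k \<in> ?K" "k > 0" "j > 0" "\<delta> ^ j = \<gamma> ^ j"
    unfolding rad_def pow_class_def by auto
  define N where "N = k * j"
  have N: "N > 0" using \<delta> N_def by simp
  have "\<gamma> ^ N = (\<delta> ^ j) ^ k" by (simp add: N_def \<delta>(4) mult.commute flip: power_mult)
  also have "\<dots> = (\<delta> ^ k) powi int j" by (simp add: mult.commute flip: power_mult)
  also have "\<dots> \<in> ?K" by (rule is_subfield_power_int[OF is_subfield_galois_closure \<delta>(1)])
  finally have \<gamma>N: "\<gamma> ^ N \<in> ?K" .
  \<comment> \<open>\<open>m\<close> removes torsion, \<open>b\<close> the denominator of
    \<open>s\<close>, and \<open>N\<close> brings the resulting power of \<open>\<gamma>\<close>
    into the closure.\<close>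
  define n where "n = m * nat b * N"
  have n: "n > 0" using m b N n_def by simp
  have int_n: "int n = int m * b * int N" using b by (simp add: n_def)
  have "\<beta> ^ n = \<beta> powi int n" by simp
  also have "\<dots> = (\<beta> powi (int m * b)) powi int N" unfolding int_n by (rule power_int_mult)
  also have "\<dots> = \<gamma> powi (int N * (int m * a))"
    unfolding m(2) power_int_mult[symmetric] by (simp only: mult.commute)
  also have "\<dots> = (\<gamma> ^ N) powi (int m * a)" unfolding power_int_mult by simp
  also have "\<dots> \<in> ?K" by (rule is_subfield_power_int[OF is_subfield_galois_closure \<gamma>N])
  finally obtain x L where x: "x \<in> ?K" "L > 0" "x ^ n = \<beta> ^ (n * L)" "mahler x \<le> mahler \<beta>"
    using radical_descent[OF \<alpha> \<beta>0(2) n] by blast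
  define r where "r = s * of_nat L"
  obtain c d where cd: "quotient_of r = (c, d)" by fastforce
  have d: "d > 0" using quotient_of_denom_pos[OF cd] .
  \<comment> \<open>\<open>quotient_of\<close> reduces to lowest terms, so \<open>c\<close> and
    \<open>d\<close> may differ from \<open>a * L\<close> and \<open>b\<close>; exponents are
    compared through the cross-multiplied identity.\<close>
  have "(of_int c / of_int d :: rat) = of_int a / of_int b * of_nat L"
    using quotient_of_div[OF cd] quotient_of_div[OF ab] r_def by simp
  hence "(of_int (c * b) :: rat) = of_int (a * int L * d)" using b d by (simp add: field_simps)
  hence cross: "c * b = a * int L * d" by (simp only: of_int_eq_iff)
  have "x powi (int (n * nat b) * d) = x powi (int n * (b * d))" using b by (simp add: mult.assoc)
  also have "\<dots> = (x ^ n) powi (b * d)" unfolding power_int_mult[of x "int n" "b * d"] by simp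
  also have "\<dots> = (\<beta> powi int (n * L)) powi (b * d)"
    unfolding x(3) by (simp only: power_int_of_nat)
  also have "\<dots> = \<beta> powi (int n * int L * (b * d))" unfolding power_int_mult[symmetric] by simp
  also have "int n * int L * (b * d) = (int m * b) * (int N * int L * b * d)"
    unfolding int_n by (simp add: mult_ac)
  also have "\<beta> powi \<dots> = \<gamma> powi ((int m * a) * (int N * int L * b * d))"
    using m(2) by (simp only: power_int_mult)
  also have "(int m * a) * (int N * int L * b * d) = int m * int N * b * (a * int L * d)"
    by (simp add: mult_ac)
  also have "\<dots> = int (n * nat b) * c"
    unfolding cross[symmetric] n_def using b by (simp add: mult_ac)
  finally have eq: "x powi (int (n * nat b) * d) = \<gamma> powi (int (n * nat b) * c)" .
  have "x \<noteq> 0" using x(3) \<beta>0(1) n by (metis power_not_zero zero_power)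
  hence "x \<in> pow_class \<gamma> r"
    unfolding pow_class_def mem_Collect_eq cd fst_conv snd_conv
    using eq n b galois_closure_algebraic[OF \<alpha> x(1)]
    by (intro conjI exI[of _ "n * nat b"]) simp_all
  moreover have "r \<noteq> 0" using s x(2) r_def by simp
  ultimately show ?thesis using that x by blast
qed

section \<open>Attaining the infimum\<close>

theorem mainTheorem8:
  fixes \<alpha> \<gamma> :: complex
  assumes "algebraic \<alpha>" and "\<alpha> \<noteq> 0"
    and "algebraic \<gamma>" and "\<gamma> \<noteq> 0"
    and "in_S \<gamma> (galois_closure \<alpha>)"
    and "Mbar_pow \<gamma> 1 \<le> mahler \<alpha>"
  shows "\<exists>r::rat. r \<noteq> 0 \<and>
           Mbar_pow \<gamma> r = Inf {Mbar_pow \<gamma> s | s. s \<noteq> 0} \<and>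
           (\<exists>\<beta>\<in>B_set \<alpha>. \<beta> \<in> pow_class \<gamma> r)"
proof -
  let ?K = "galois_closure \<alpha>"
  define X where "X = {x \<in> ?K. \<exists>r. r \<noteq> 0 \<and> x \<in> pow_class \<gamma> r}"
  have descent: "\<exists>x\<in>X. mahler x \<le> mahler \<beta>" if s: "s \<noteq> 0" "\<beta> \<in> pow_class \<gamma> s" for s \<beta>
  proof -
    obtain x r where "r \<noteq> 0" "x \<in> pow_class \<gamma> r" "x \<in> ?K" "mahler x \<le> mahler \<beta>"
      by (rule pow_class_descent[OF assms(1,5) s])
    thus ?thesis unfolding X_def by blast
  qed
  obtain \<beta>1 where "\<beta>1 \<in> pow_class \<gamma> 1" using pow_class_nonempty[OF assms(3,4)] by blast
  then obtain x1 where x1: "x1 \<in> X" using descent[OF one_neq_zero] by blast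
  \<comment> \<open>The cut at \<open>mahler x1\<close> makes the set finite without losing the
    minimum over \<open>X\<close>.\<close>
  define V where "V = {mahler x | x. x \<in> X \<and> mahler x \<le> mahler x1}"
  have "V \<subseteq> {mahler x | x. x \<in> ?K \<and> mahler x \<le> mahler x1}" unfolding V_def X_def by blast
  hence finV: "finite V" by (rule finite_subset[OF _ finite_mahler_values[OF assms(1)]])
  have "mahler x1 \<in> V" unfolding V_def using x1 by blast
  hence "Min V \<in> V" using finV by (intro Min_in) auto
  then obtain x0 where x0: "x0 \<in> X" "mahler x0 \<le> mahler x1" "Min V = mahler x0"
    unfolding V_def by blast
  have min: "mahler x0 \<le> mahler x" if "x \<in> X" for x
  proof (cases "mahler x \<le> mahler x1")
    case True
    hence "mahler x \<in> V" unfolding V_def using that by blast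
    thus ?thesis unfolding x0(3)[symmetric] by (rule Min_le[OF finV])
  qed (use x0(2) in linarith)
  obtain r where r: "r \<noteq> 0" "x0 \<in> pow_class \<gamma> r" and x0K: "x0 \<in> ?K" using x0(1) X_def by blast
  have lower: "mahler x0 \<le> Mbar_pow \<gamma> s" if s: "s \<noteq> 0" for s
    unfolding Mbar_pow_def
  proof (rule cInf_greatest)
    show "mahler ` pow_class \<gamma> s \<noteq> {}" using pow_class_nonempty[OF assms(3,4)] by blast
    fix v assume "v \<in> mahler ` pow_class \<gamma> s"
    then obtain \<beta> where \<beta>: "\<beta> \<in> pow_class \<gamma> s" "v = mahler \<beta>" by blast
    then obtain x where "x \<in> X" "mahler x \<le> v" using descent[OF s] by blast
    thus "mahler x0 \<le> v" using min by force
  qed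
  have "Mbar_pow \<gamma> r \<le> mahler x0"
    unfolding Mbar_pow_def
  proof (rule cInf_lower)
    show "bdd_below (mahler ` pow_class \<gamma> r)"
    proof (rule bdd_belowI2)
      fix \<beta> assume "\<beta> \<in> pow_class \<gamma> r"
      hence "algebraic \<beta>" unfolding pow_class_def by simp
      thus "0 \<le> mahler \<beta>" using mahler_pos by (simp add: less_imp_le)
    qed
    show "mahler x0 \<in> mahler ` pow_class \<gamma> r" using r(2) by (rule imageI)
  qed
  hence eq: "Mbar_pow \<gamma> r = mahler x0" using lower[OF r(1)] by simp
  have "Inf {Mbar_pow \<gamma> s | s. s \<noteq> 0} = mahler x0"
  proof (rule cInf_eq_minimum)
    show "mahler x0 \<in> {Mbar_pow \<gamma> s | s. s \<noteq> 0}" unfolding eq[symmetric] using r(1) by blast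
    fix v assume "v \<in> {Mbar_pow \<gamma> s | s. s \<noteq> 0}"
    then obtain s where "s \<noteq> 0" "v = Mbar_pow \<gamma> s" by blast
    thus "mahler x0 \<le> v" using lower by simp
  qed
  hence "Mbar_pow \<gamma> r = Inf {Mbar_pow \<gamma> s | s. s \<noteq> 0}" using eq by (rule trans[OF _ sym, rotated])
  moreover have "x0 \<noteq> 0" using r(2) unfolding pow_class_def by simp
  \<comment> \<open>The lower bound at exponent 1 gives
    \<open>mahler x0 \<le> Mbar_pow \<gamma> 1\<close>, and this is at most
    \<open>mahler \<alpha>\<close> by assumption.\<close>
  hence "x0 \<in> B_set \<alpha>"
    unfolding B_set_def using x0K order_trans[OF lower[OF one_neq_zero] assms(6)] by simp
  ultimately show ?thesis using r by blast
qed

end
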